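(* Let $\Gamma$ be a discrete subgroup of $\mathrm{Isom}^+(\mathbb{H}^4)$ acting freely on $\mathbb{H}^4$, and suppose $\infty\in\partial\mathbb{H}^4$ is a parabolic fixed point of $\Gamma$ with stabilizer $\Gamma_\infty=\{\gamma\in\Gamma:\gamma(\infty)=\infty\}$. If $\Gamma_\infty$ contains an irrational screw translation, then $\Gamma_\infty$ is an infinite cyclic group.
   Context: $\mathbb{H}^4=\{(v,t):v\in\mathbb{R}^3,t>0\}$ is the upper half-space model of hyperbolic 4-space, with boundary $\partial\mathbb{H}^4=\mathbb{R}^3\cup\{\infty\}$, and $\mathrm{Isom}^+(\mathbb{H}^4)$ is its group of orientation-preserving isometries. A non-identity isometry is parabolic if its fixed point set in $\mathbb{H}^4\cup\partial\mathbb{H}^4$ is a single point lying on $\partial\mathbb{H}^4$. A parabolic fixed point of $\Gamma$ is a point fixed by some parabolic element of $\Gamma$. Every parabolic is conjugate in $\mathrm{Isom}^+(\mathbb{H}^4)$ to a map $(v,t)\mapsto(Av+a,t)$ with $A\in\mathrm{SO}(3)$, $a\in\mathbb{R}^3\setminus\{0\}$, $Aa=a$, where the conjugacy class of $A$ in $\mathrm{SO}(3)$ is uniquely determined. The parabolic is a screw translation if $A\ne I$, and an irrational screw translation if $A$ has infinite order. *)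

theory Defs
  imports "HOL-Analysis.Analysis" "HOL-Algebra.Bij" "HOL-Algebra.Elementary_Groups"
begin

section \<open>The upper half-space model of hyperbolic 4-space\<close>

type_synonym hpoint = "(real^3) \<times> real"

definition H4 :: "hpoint set" where
  "H4 = {(v, t). 0 < t}"

text \<open>The norm on the product type is Euclidean, so \<^term>\<open>dist p q\<close> is the Euclidean
  distance in 4-space.\<close>

definition hyp_dist :: "hpoint \<Rightarrow> hpoint \<Rightarrow> real" where
  "hyp_dist p q = arcosh (1 + (dist p q)\<^sup>2 / (2 * snd p * snd q))"

section \<open>Orientation-preserving isometries\<close>

text \<open>The index type \<^typ>\<open>3 option\<close> has four elements; \<^term>\<open>None\<close> indexes the height
  coordinate. The determinant of an endomorphism does not depend on the ordering of the
  coordinates.\<close>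

definition to_vec4 :: "hpoint \<Rightarrow> real^(3 option)" where
  "to_vec4 p = (\<chi> i. case i of None \<Rightarrow> snd p | Some j \<Rightarrow> fst p $ j)"

definition of_vec4 :: "real^(3 option) \<Rightarrow> hpoint" where
  "of_vec4 x = ((\<chi> j. x $ Some j), x $ None)"

definition det4 :: "(hpoint \<Rightarrow> hpoint) \<Rightarrow> real" where
  "det4 D = det (matrix (to_vec4 \<circ> D \<circ> of_vec4))"

definition hyp_isometry :: "(hpoint \<Rightarrow> hpoint) \<Rightarrow> bool" where
  "hyp_isometry f \<longleftrightarrow> f \<in> Bij H4 \<and> (\<forall>p\<in>H4. \<forall>q\<in>H4. hyp_dist (f p) (f q) = hyp_dist p q)"

definition orientation_preserving :: "(hpoint \<Rightarrow> hpoint) \<Rightarrow> bool" where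
  "orientation_preserving f \<longleftrightarrow>
     (\<forall>p\<in>H4. \<exists>D. (f has_derivative D) (at p) \<and> det4 D > 0)"

text \<open>Elements of the group are extensional functions: outside \<^term>\<open>H4\<close> they take the value
  \<^term>\<open>undefined\<close>.\<close>

definition Isom_plus :: "(hpoint \<Rightarrow> hpoint) monoid" where
  "Isom_plus = (BijGroup H4)\<lparr>carrier := {f. hyp_isometry f \<and> orientation_preserving f}\<rparr>"

text \<open>The topology on the function type is that of pointwise convergence. On isometries of
  \<^term>\<open>H4\<close> it coincides with the compact-open topology, i.e. with the Lie group topology.\<close>

definition discrete_subgroup :: "(hpoint \<Rightarrow> hpoint) set \<Rightarrow> bool" where
  "discrete_subgroup \<Gamma> \<longleftrightarrow> subgroup \<Gamma> Isom_plus \<and> discrete \<Gamma>"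

definition acts_freely :: "(hpoint \<Rightarrow> hpoint) set \<Rightarrow> bool" where
  "acts_freely \<Gamma> \<longleftrightarrow> (\<forall>\<gamma>\<in>\<Gamma>. \<forall>p\<in>H4. \<gamma> p = p \<longrightarrow> \<gamma> = \<one>\<^bsub>Isom_plus\<^esub>)"

section \<open>The boundary at infinity\<close>

datatype boundary_point = Finite_Pt "real^3" | Infinity_Pt

text \<open>The trace on \<^term>\<open>H4\<close> of the neighbourhoods of a boundary point in the closed ball
  compactification.\<close>

fun boundary_filter :: "boundary_point \<Rightarrow> hpoint filter" where
  "boundary_filter (Finite_Pt v) = inf (nhds (v, 0)) (principal H4)"
| "boundary_filter Infinity_Pt = inf at_infinity (principal H4)"

text \<open>An isometry acts on the boundary by its continuous extension. The relation below says that
  this extension maps \<open>\<xi>\<close> to \<open>\<eta>\<close>.\<close>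

definition boundary_maps_to ::
  "(hpoint \<Rightarrow> hpoint) \<Rightarrow> boundary_point \<Rightarrow> boundary_point \<Rightarrow> bool" where
  "boundary_maps_to \<gamma> \<xi> \<eta> \<longleftrightarrow> filterlim \<gamma> (boundary_filter \<eta>) (boundary_filter \<xi>)"

definition fixed_points ::
  "(hpoint \<Rightarrow> hpoint) \<Rightarrow> (hpoint + boundary_point) set" where
  "fixed_points \<gamma> = Inl ` {p \<in> H4. \<gamma> p = p} \<union> Inr ` {\<xi>. boundary_maps_to \<gamma> \<xi> \<xi>}"

definition boundary_stabilizer ::
  "(hpoint \<Rightarrow> hpoint) set \<Rightarrow> boundary_point \<Rightarrow> (hpoint \<Rightarrow> hpoint) set" where
  "boundary_stabilizer \<Gamma> \<xi> = {\<gamma> \<in> \<Gamma>. boundary_maps_to \<gamma> \<xi> \<xi>}"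

section \<open>Parabolic isometries and screw translations\<close>

definition parabolic :: "(hpoint \<Rightarrow> hpoint) \<Rightarrow> bool" where
  "parabolic \<gamma> \<longleftrightarrow> \<gamma> \<in> carrier Isom_plus \<and> \<gamma> \<noteq> \<one>\<^bsub>Isom_plus\<^esub> \<and> (\<exists>\<xi>. fixed_points \<gamma> = {Inr \<xi>})"

definition parabolic_fixed_point ::
  "(hpoint \<Rightarrow> hpoint) set \<Rightarrow> boundary_point \<Rightarrow> bool" where
  "parabolic_fixed_point \<Gamma> \<xi> \<longleftrightarrow> (\<exists>\<gamma>\<in>\<Gamma>. parabolic \<gamma> \<and> boundary_maps_to \<gamma> \<xi> \<xi>)"

definition parabolic_normal_form :: "real^3^3 \<Rightarrow> real^3 \<Rightarrow> hpoint \<Rightarrow> hpoint" where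
  "parabolic_normal_form A a = (\<lambda>p\<in>H4. (A *v fst p + a, snd p))"

text \<open>\<open>A\<close> is a rotational part of \<open>\<gamma>\<close>; it is unique up to conjugation in SO(3).\<close>

definition rotational_part :: "(hpoint \<Rightarrow> hpoint) \<Rightarrow> real^3^3 \<Rightarrow> bool" where
  "rotational_part \<gamma> A \<longleftrightarrow> rotation_matrix A \<and>
     (\<exists>a. a \<noteq> 0 \<and> A *v a = a \<and>
       (\<exists>h\<in>carrier Isom_plus.
          h \<otimes>\<^bsub>Isom_plus\<^esub> \<gamma> \<otimes>\<^bsub>Isom_plus\<^esub> inv\<^bsub>Isom_plus\<^esub> h = parabolic_normal_form A a))"

definition screw_translation :: "(hpoint \<Rightarrow> hpoint) \<Rightarrow> bool" where
  "screw_translation \<gamma> \<longleftrightarrow> parabolic \<gamma> \<and> (\<exists>A. rotational_part \<gamma> A \<and> A \<noteq> mat 1)"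

text \<open>\<open>((**) A ^^ n) (mat 1)\<close> is the \<open>n\<close>-th matrix power of \<open>A\<close>; the operator \<open>^\<close> on this type
  is the componentwise power.\<close>

definition infinite_order :: "real^3^3 \<Rightarrow> bool" where
  "infinite_order A \<longleftrightarrow> (\<forall>n>0. (((**) A) ^^ n) (mat 1) \<noteq> mat 1)"

definition irrational_screw_translation :: "(hpoint \<Rightarrow> hpoint) \<Rightarrow> bool" where
  "irrational_screw_translation \<gamma> \<longleftrightarrow>
     screw_translation \<gamma> \<and> (\<exists>A. rotational_part \<gamma> A \<and> infinite_order A)"

end

theory Submission
  imports Defs
begin

text \<open>
  The isometries of hyperbolic space fixing \<open>\<infinity>\<close> are the Euclidean similarities
  \<open>v \<mapsto> c + l B (v - c) + b\<close> of the boundary \<open>\<real>\<^sup>3\<close>, extended to heights by multiplication with \<open>l\<close>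
  (\<open>fixes_infinity_sim\<close>). So \<open>\<Gamma>\<^sub>\<infinity>\<close> is a discrete group of similarities acting freely, and the
  irrational screw translation in it is a screw motion \<open>v \<mapsto> c + A (v - c) + a\<close> with axis
  \<open>L = c + \<real> a\<close> (\<open>screw_normal_form_at_infinity\<close>).

  A contraction in \<open>\<Gamma>\<^sub>\<infinity>\<close> would conjugate the screw motion to infinitely many isometries moving the
  fixed point of the contraction by ever smaller amounts. Discreteness rules this out
  (\<open>no_contraction\<close>), so \<open>\<Gamma>\<^sub>\<infinity>\<close> consists of Euclidean isometries.

  The heart of the proof is that every \<open>f\<close> in \<open>\<Gamma>\<^sub>\<infinity>\<close> preserves \<open>L\<close>
  (\<open>preserves_axis_of_screw\<close>). The powers of \<open>A\<close> lie in a compact group, so some power \<open>u\<close> of the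
  screw motion has linear part near the identity. For such \<open>u\<close> the sequence \<open>w\<^sub>0 = f\<close>,
  \<open>w\<^bsub>k+1\<^esub> = w\<^sub>k u w\<^sub>k\<^sup>-\<^sup>1\<close> converges to \<open>u\<close>: this is the commutator estimate of Bieberbach and Zassenhaus.
  By discreteness \<open>w\<^sub>k = u\<close> for some \<open>k\<close>. Now go back: if \<open>w u w\<^sup>-\<^sup>1\<close> preserves \<open>L\<close>, then \<open>u\<close>
  preserves the line \<open>w\<^sup>-\<^sup>1 L\<close>; but \<open>L\<close> is the only line preserved by \<open>u\<close>, because its
  linear part has infinite order; hence \<open>w\<close> preserves \<open>L\<close>. Since \<open>u = w\<^sub>k\<close> preserves \<open>L\<close>, so
  does \<open>w\<^sub>0 = f\<close>.

  An element of \<open>\<Gamma>\<^sub>\<infinity>\<close> reversing \<open>L\<close> would fix a point of \<open>L\<close>, against freeness. So every element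
  translates \<open>L\<close> by a multiple of \<open>a\<close> (\<open>translation_along_axis\<close>). This multiple is a homomorphism
  to \<open>\<real>\<close>. It is injective, since an element acting trivially on \<open>L\<close> has a fixed point, and only
  finitely many elements translate by a bounded amount, since their linear parts lie in a compact
  group. Thus \<open>\<Gamma>\<^sub>\<infinity>\<close> is isomorphic to a nonzero discrete subgroup of \<open>\<real>\<close>, i.e. to \<open>\<int>\<close>.
\<close>

section \<open>Groups embedded in the real line\<close>

text \<open>An element \<open>m\<close> with the least positive value of \<open>\<phi>\<close> generates: dividing \<open>\<phi> x\<close> by \<open>\<phi> m\<close> with
  remainder gives a power of \<open>m\<close> that differs from \<open>x\<close> by an element whose value lies in
  \<open>[0, \<phi> m)\<close>, hence is \<open>0\<close>.\<close>

lemma cyclic_group_if_locally_finite_real_hom: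
  fixes G (structure) and \<phi> :: "'a \<Rightarrow> real"
  assumes "group G"
    and hom: "\<And>x y. x \<in> carrier G \<Longrightarrow> y \<in> carrier G \<Longrightarrow> \<phi> (x \<otimes>\<^bsub>G\<^esub> y) = \<phi> x + \<phi> y"
    and ker: "\<And>x. x \<in> carrier G \<Longrightarrow> \<phi> x = 0 \<Longrightarrow> x = \<one>\<^bsub>G\<^esub>"
    and fin: "\<And>R. finite {x \<in> carrier G. \<bar>\<phi> x\<bar> \<le> R}"
    and g: "g \<in> carrier G" "\<phi> g \<noteq> 0"
  shows "cyclic_group G \<and> infinite (carrier G)"
proof -
  interpret group G by fact
  have one: "\<phi> \<one> = 0"
    using hom[of \<one> \<one>] by simp
  have inv: "\<phi> (inv x) = - \<phi> x" if "x \<in> carrier G" for x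
    using hom[of x "inv x"] that one by simp
  have nat_pow: "\<phi> (x [^] (n::nat)) = real n * \<phi> x" if "x \<in> carrier G" for x n
    using that by (induction n) (auto simp: one hom algebra_simps)
  have int_pow: "\<phi> (x [^] (n::int)) = real_of_int n * \<phi> x" if "x \<in> carrier G" for x n
    using that by (cases n rule: int_cases)
      (simp_all add: int_pow_int int_pow_neg_int inv hom nat_pow distrib_right del: of_nat_Suc, simp add: distrib_right)
  obtain h where h: "h \<in> carrier G" "\<phi> h > 0"
  proof (cases "\<phi> g > 0")
    case False
    then have "\<phi> (inv g) > 0"
      using g inv[of g] by simp
    then show ?thesis
      using that g by blast
  qed (use g in blast)
  define S where "S = {x \<in> carrier G. 0 < \<phi> x \<and> \<phi> x \<le> \<phi> h}"
  have "finite S"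
    by (rule finite_subset[OF _ fin[of "\<phi> h"]]) (auto simp: S_def)
  moreover have "h \<in> S"
    using h by (simp add: S_def)
  ultimately obtain m where m: "m \<in> S" "\<And>x. x \<in> S \<Longrightarrow> \<phi> m \<le> \<phi> x"
    using arg_min_if_finite[of S \<phi>] that[of "arg_min_on \<phi> S"] by (auto simp: not_less)
  have mG: "m \<in> carrier G" and mpos: "\<phi> m > 0"
    using m by (auto simp: S_def)
  have "x \<in> range (\<lambda>n::int. m [^] n)" if x: "x \<in> carrier G" for x
  proof -
    define n where "n = \<lfloor>\<phi> x / \<phi> m\<rfloor>"
    define y where "y = x \<otimes> inv (m [^] n)"
    have y: "y \<in> carrier G"
      using x mG by (simp add: y_def)
    have "\<phi> y = \<phi> x - n * \<phi> m"
      using x mG by (simp add: y_def hom inv int_pow)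
    moreover have "n * \<phi> m \<le> \<phi> x" "\<phi> x < (n + 1) * \<phi> m"
      using mpos by (auto simp: n_def pos_le_divide_eq[symmetric] pos_divide_less_eq[symmetric])
    ultimately have "0 \<le> \<phi> y" "\<phi> y < \<phi> m"
      by (auto simp: algebra_simps)
    then have "\<phi> y = 0"
      using m(2)[of y] m(1) y by (fastforce simp: S_def)
    then have "y = \<one>"
      using ker y by blast
    then have "x = m [^] n"
      unfolding y_def using inv_solve_right[of \<one> x "m [^] n"] x mG by fastforce
    then show ?thesis by blast
  qed
  then have "carrier G = range (\<lambda>n::int. m [^] n)"
    using mG by auto
  then have "cyclic_group G"
    using cyclic_group mG by blast
  moreover have "infinite (carrier G)"
  proof
    assume "finite (carrier G)"
    then have "finite (range (\<lambda>n::nat. m [^] n))"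
      by (rule finite_subset[rotated]) (use mG in auto)
    moreover have "inj (\<lambda>n::nat. m [^] n)"
    proof (rule injI)
      fix j k :: nat
      assume "m [^] j = m [^] k"
      then have "real j * \<phi> m = real k * \<phi> m"
        using nat_pow[OF mG] by metis
      then show "j = k"
        using mpos by simp
    qed
    ultimately show False
      using finite_imageD infinite_UNIV_nat by blast
  qed
  ultimately show ?thesis by blast
qed

section \<open>The isometry group\<close>

lemma to_vec4_of_vec4 [simp]: "to_vec4 (of_vec4 x) = x"
  by (auto simp: to_vec4_def of_vec4_def vec_eq_iff split: option.split)

lemma of_vec4_to_vec4 [simp]: "of_vec4 (to_vec4 p) = p"
  by (auto simp: to_vec4_def of_vec4_def vec_eq_iff prod_eq_iff)

lemma linear_to_vec4: "linear to_vec4"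
  by (rule linearI) (auto simp: to_vec4_def vec_eq_iff split: option.split)

lemma linear_of_vec4: "linear of_vec4"
  by (rule linearI) (auto simp: of_vec4_def vec_eq_iff prod_eq_iff)

lemma det4_comp:
  assumes "linear D" "linear E"
  shows "det4 (D \<circ> E) = det4 D * det4 E"
proof -
  have *: "linear (to_vec4 \<circ> D \<circ> of_vec4)" if "linear D" for D
    using that by (intro linear_compose linear_to_vec4 linear_of_vec4)
  have "to_vec4 \<circ> (D \<circ> E) \<circ> of_vec4 = (to_vec4 \<circ> D \<circ> of_vec4) \<circ> (to_vec4 \<circ> E \<circ> of_vec4)"
    by (auto simp: fun_eq_iff)
  then show ?thesis
    unfolding det4_def using matrix_compose[OF *[OF assms(2)] *[OF assms(1)]]
    by (simp add: det_mul)
qed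

lemma det4_id: "det4 id = 1"
proof -
  have "to_vec4 \<circ> id \<circ> of_vec4 = id"
    by (auto simp: fun_eq_iff)
  then show ?thesis
    unfolding det4_def by (metis matrix_id det_I)
qed

lemma invertible_if_det4_pos:
  assumes "linear D" "det4 D > 0"
  obtains E where "D \<circ> E = id" "linear E"
proof -
  let ?f = "to_vec4 \<circ> D \<circ> of_vec4"
  have lin: "linear ?f"
    using assms by (intro linear_compose linear_to_vec4 linear_of_vec4)
  have "invertible (matrix ?f)"
    using assms by (simp add: det4_def invertible_det_nz)
  then obtain B where B: "matrix ?f ** B = mat 1"
    by (auto simp: invertible_def)
  define E where "E = of_vec4 \<circ> (*v) B \<circ> to_vec4"
  have "?f (B *v x) = x" for x
  proof -
    have "?f (B *v x) = matrix ?f *v (B *v x)"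
      using matrix_works[OF lin[unfolded linear_matrix_vector_mul_eq[symmetric]]] by simp
    then show ?thesis
      by (simp only: matrix_vector_mul_assoc B matrix_vector_mul_lid)
  qed
  then have "to_vec4 (D (E p)) = to_vec4 p" for p
    by (simp add: E_def)
  then have "D (E p) = p" for p
    by (metis of_vec4_to_vec4)
  then have "D \<circ> E = id" by auto
  moreover have "linear E"
    unfolding E_def by (intro linear_compose linear_to_vec4 linear_of_vec4) auto
  ultimately show thesis ..
qed

lemma open_H4: "open H4"
proof -
  have "H4 = snd -` {0<..}" by (auto simp: H4_def)
  then show ?thesis by (metis open_vimage_snd open_greaterThan)
qed

lemma Isom_plus_sel [simp]:
  "mult Isom_plus = mult (BijGroup H4)" "one Isom_plus = (\<lambda>p\<in>H4. p)"
  "carrier Isom_plus = {f. hyp_isometry f \<and> orientation_preserving f}"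
  by (auto simp: Isom_plus_def BijGroup_def)

lemma hyp_isometryD:
  assumes "hyp_isometry f"
  shows "f \<in> Bij H4" "\<And>p. p \<in> H4 \<Longrightarrow> f p \<in> H4"
    "\<And>p q. p \<in> H4 \<Longrightarrow> q \<in> H4 \<Longrightarrow> hyp_dist (f p) (f q) = hyp_dist p q"
    "\<And>p q. p \<in> H4 \<Longrightarrow> q \<in> H4 \<Longrightarrow> f p = f q \<Longrightarrow> p = q"
  using assms by (auto simp: hyp_isometry_def Bij_def bij_betw_def inj_on_def)

lemma has_derivative_cong_H4:
  assumes "p \<in> H4" "\<And>q. q \<in> H4 \<Longrightarrow> f q = g q" "(g has_derivative D) (at p)"
  shows "(f has_derivative D) (at p)"
  using has_derivative_transform_within_open[OF assms(3) open_H4 assms(1)] assms(2) by metis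

text \<open>The derivative of the inverse is the inverse of the derivative, with determinant
  \<open>1 / det\<close>. The differentiability of the inverse comes from the inverse function theorem without
  continuity of the derivative, which needs only that the map is injective and continuous on an
  open set.\<close>

lemma orientation_preserving_inverse:
  assumes f: "hyp_isometry f" "orientation_preserving f"
  shows "orientation_preserving (restrict (inv_into H4 f) H4)"
  unfolding orientation_preserving_def
proof
  fix y assume "y \<in> H4"
  then have "y \<in> f ` H4"
    using f(1) by (simp add: hyp_isometry_def Bij_def bij_betw_def)
  then obtain x where x: "x \<in> H4" "f x = y"
    by blast
  let ?g = "restrict (inv_into H4 f) H4"
  have gf: "?g (f z) = z" if "z \<in> H4" for z
    using hyp_isometryD[OF f(1)] that by (simp add: inj_on_def)
  obtain D where D: "(f has_derivative D) (at x)" "det4 D > 0"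
    using f(2) x by (auto simp: orientation_preserving_def)
  have linD: "linear D"
    using D(1) has_derivative_linear by blast
  obtain E where E: "D \<circ> E = id" "linear E"
    using invertible_if_det4_pos[OF linD D(2)] .
  have "continuous_on H4 f"
    using f(2) has_derivative_continuous unfolding orientation_preserving_def
    by (metis continuous_at_imp_continuous_on)
  from has_derivative_inverse_strong[OF open_H4 x(1) this gf D(1) E(1)]
  have "(?g has_derivative E) (at y)"
    unfolding x(2) .
  moreover have "det4 E > 0"
    using det4_comp[OF linD E(2)] E(1) det4_id D(2) by (metis zero_less_mult_pos zero_less_one)
  ultimately show "\<exists>D. (?g has_derivative D) (at y) \<and> det4 D > 0"
    by blast
qed

lemma subgroup_Isom_plus: "subgroup (carrier Isom_plus) (BijGroup H4)"
proof (rule group.subgroupI[OF group_BijGroup])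
  have "orientation_preserving (\<lambda>p\<in>H4. p)"
    unfolding orientation_preserving_def
  proof
    fix p assume "p \<in> H4"
    then have "((\<lambda>p\<in>H4. p) has_derivative id) (at p)"
      by (rule has_derivative_cong_H4) (auto simp: id_def)
    then show "\<exists>D. ((\<lambda>p\<in>H4. p) has_derivative D) (at p) \<and> det4 D > 0"
      using det4_id by (intro exI[of _ id]) auto
  qed
  moreover have "hyp_isometry (\<lambda>p\<in>H4. p)"
    by (auto simp: hyp_isometry_def id_Bij)
  ultimately show "carrier Isom_plus \<noteq> {}"
    by (auto intro!: exI)
next
  show "carrier Isom_plus \<subseteq> carrier (BijGroup H4)"
    by (auto simp: BijGroup_def hyp_isometry_def)
next
  fix f assume "f \<in> carrier Isom_plus"
  then have f: "hyp_isometry f" "orientation_preserving f" by auto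
  let ?g = "restrict (inv_into H4 f) H4"
  have "hyp_isometry ?g"
    unfolding hyp_isometry_def
  proof (intro conjI ballI)
    show "?g \<in> Bij H4"
      using f hyp_isometryD restrict_inv_into_Bij by blast
    fix p q assume pq: "p \<in> H4" "q \<in> H4"
    then have "inv_into H4 f p \<in> H4" "inv_into H4 f q \<in> H4"
        "f (inv_into H4 f p) = p" "f (inv_into H4 f q) = q"
      using f(1) by (auto simp: hyp_isometry_def Bij_def bij_betw_def intro!: inv_into_into f_inv_into_f)
    then show "hyp_dist (?g p) (?g q) = hyp_dist p q"
      using hyp_isometryD(3)[OF f(1)] pq by (metis restrict_apply')
  qed
  then show "inv\<^bsub>BijGroup H4\<^esub> f \<in> carrier Isom_plus"
    using f hyp_isometryD(1) orientation_preserving_inverse by (auto simp: inv_BijGroup)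
next
  fix f g assume "f \<in> carrier Isom_plus" "g \<in> carrier Isom_plus"
  then have f: "hyp_isometry f" "orientation_preserving f"
    and g: "hyp_isometry g" "orientation_preserving g" by auto
  have "hyp_isometry (compose H4 f g)"
    unfolding hyp_isometry_def using hyp_isometryD[OF f(1)] hyp_isometryD[OF g(1)]
    by (simp add: compose_Bij compose_eq)
  moreover have "orientation_preserving (compose H4 f g)"
    unfolding orientation_preserving_def
  proof
    fix p assume p: "p \<in> H4"
    obtain D where D: "(g has_derivative D) (at p)" "det4 D > 0"
      using g(2) p by (auto simp: orientation_preserving_def)
    obtain E where E: "(f has_derivative E) (at (g p))" "det4 E > 0"
      using f(2) hyp_isometryD(2)[OF g(1) p] by (auto simp: orientation_preserving_def)
    have "(f \<circ> g has_derivative E \<circ> D) (at p)"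
      using D E by (intro diff_chain_at)
    then have "(compose H4 f g has_derivative E \<circ> D) (at p)"
      by (rule has_derivative_cong_H4[OF p, rotated]) (auto simp: compose_def)
    moreover have "det4 (E \<circ> D) > 0"
      using D E by (simp add: det4_comp has_derivative_linear)
    ultimately show "\<exists>D. (compose H4 f g has_derivative D) (at p) \<and> det4 D > 0"
      by blast
  qed
  ultimately show "f \<otimes>\<^bsub>BijGroup H4\<^esub> g \<in> carrier Isom_plus"
    using f g hyp_isometryD(1) by (auto simp: BijGroup_def)
qed

lemma group_Isom_plus: "group Isom_plus"
  using subgroup.subgroup_is_group[OF subgroup_Isom_plus group_BijGroup]
  by (simp add: Isom_plus_def)

lemma Isom_plus_mult_apply:
  assumes "f \<in> carrier Isom_plus" "g \<in> carrier Isom_plus"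
  shows "f \<otimes>\<^bsub>Isom_plus\<^esub> g = compose H4 f g"
  using assms hyp_isometryD(1) by (auto simp: BijGroup_def)

lemma Isom_plus_inv_apply:
  assumes "f \<in> carrier Isom_plus" "p \<in> H4"
  shows "(inv\<^bsub>Isom_plus\<^esub> f) (f p) = p" "f ((inv\<^bsub>Isom_plus\<^esub> f) p) = p" "(inv\<^bsub>Isom_plus\<^esub> f) p \<in> H4"
proof -
  interpret group Isom_plus by (rule group_Isom_plus)
  have i: "inv\<^bsub>Isom_plus\<^esub> f \<in> carrier Isom_plus" using assms by blast
  have "compose H4 (inv\<^bsub>Isom_plus\<^esub> f) f = (\<lambda>p\<in>H4. p)"
    using Isom_plus_mult_apply[OF i assms(1)] l_inv[OF assms(1)] by (simp only: Isom_plus_sel(2))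
  from fun_cong[OF this, of p] show "(inv\<^bsub>Isom_plus\<^esub> f) (f p) = p"
    using assms(2) by (simp add: compose_eq)
  have "compose H4 f (inv\<^bsub>Isom_plus\<^esub> f) = (\<lambda>p\<in>H4. p)"
    using Isom_plus_mult_apply[OF assms(1) i] r_inv[OF assms(1)] by (simp only: Isom_plus_sel(2))
  from fun_cong[OF this, of p] show "f ((inv\<^bsub>Isom_plus\<^esub> f) p) = p"
    using assms(2) by (simp add: compose_eq)
  show "(inv\<^bsub>Isom_plus\<^esub> f) p \<in> H4"
    using i assms(2) hyp_isometryD(2)[of "inv\<^bsub>Isom_plus\<^esub> f"] by simp
qed

section \<open>Isometries fixing infinity are similarities\<close>

text \<open>The quotient determines the hyperbolic distance and is easier to handle than \<open>arcosh\<close>.\<close>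

lemma hyp_isometry_dist:
  assumes "hyp_isometry f" "p \<in> H4" "q \<in> H4"
  shows "(dist (f p) (f q))\<^sup>2 / (snd (f p) * snd (f q)) = (dist p q)\<^sup>2 / (snd p * snd q)"
proof -
  let ?r = "\<lambda>p q :: hpoint. (dist p q)\<^sup>2 / (2 * snd p * snd q)"
  have pos: "?r p q \<ge> 0" if "p \<in> H4" "q \<in> H4" for p q
    using that by (auto simp: H4_def)
  have "arcosh (1 + ?r (f p) (f q)) = arcosh (1 + ?r p q)"
    using hyp_isometryD(3)[OF assms] by (simp add: hyp_dist_def)
  then have "cosh (arcosh (1 + ?r (f p) (f q))) = cosh (arcosh (1 + ?r p q))"
    by simp
  then have "?r (f p) (f q) = ?r p q"
    using pos[OF assms(2,3)] pos[OF hyp_isometryD(2)[OF assms(1,2)] hyp_isometryD(2)[OF assms(1,3)]]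
    by (simp add: cosh_arcosh_real)
  then have "2 * ?r (f p) (f q) = 2 * ?r p q"
    by simp
  then show ?thesis
    by (simp add: mult.assoc)
qed

lemma dist_filterlim_at_top:
  fixes q :: "nat \<Rightarrow> 'a::real_normed_vector"
  assumes "filterlim q at_infinity sequentially"
  shows "filterlim (\<lambda>k. dist p (q k)) at_top sequentially"
proof (rule filterlim_at_top_mono)
  show "filterlim (\<lambda>k. - norm p + norm (q k)) at_top sequentially"
    by (rule filterlim_tendsto_add_at_top[OF tendsto_const filterlim_at_infinity_imp_norm_at_top[OF assms]])
  show "\<forall>\<^sub>F k in sequentially. - norm p + norm (q k) \<le> dist p (q k)"
    by (intro always_eventually allI) (smt (verit) dist_commute dist_norm norm_triangle_sub)
qed

lemma dist_ratio_tendsto_1: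
  fixes q :: "nat \<Rightarrow> 'a::real_normed_vector"
  assumes "filterlim q at_infinity sequentially"
  shows "(\<lambda>k. dist p (q k) / dist p' (q k)) \<longlonglongrightarrow> 1"
proof -
  note top = dist_filterlim_at_top[OF assms, of p']
  have "(\<lambda>k. dist p p' / dist p' (q k)) \<longlonglongrightarrow> 0"
    by (rule tendsto_divide_0[OF tendsto_const filterlim_at_top_imp_at_infinity[OF top]])
  then have "(\<lambda>k. dist p (q k) / dist p' (q k) - 1) \<longlonglongrightarrow> 0"
  proof (rule Lim_null_comparison[rotated])
    have "\<forall>\<^sub>F k in sequentially. dist p' (q k) > 0"
      using top unfolding filterlim_at_top_dense by blast
    then show "\<forall>\<^sub>F k in sequentially. norm (dist p (q k) / dist p' (q k) - 1) \<le> dist p p' / dist p' (q k)"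
    proof eventually_elim
      case (elim k)
      have "\<bar>dist p (q k) - dist p' (q k)\<bar> \<le> dist p p'"
        by (smt (verit) dist_commute dist_triangle)
      moreover have "dist p (q k) / dist p' (q k) - 1 = (dist p (q k) - dist p' (q k)) / dist p' (q k)"
        using elim by (simp add: diff_divide_distrib)
      ultimately show ?case
        using elim by (simp add: divide_right_mono)
    qed
  qed
  then show ?thesis
    by (simp add: LIM_zero_iff)
qed

text \<open>Let \<open>f\<close> map a sequence \<open>q\<close> tending to \<open>\<infinity>\<close> to one tending to \<open>\<infinity>\<close>, and let \<open>e\<close> be a
  reference point. Compare the
  invariant quotients of \<open>(p, q k)\<close> and \<open>(e, q k)\<close> before and after applying \<open>f\<close>: the Euclidean distances
  to \<open>q k\<close> cancel in the limit, and what remains says that the height of \<open>f p\<close> is proportional to the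
  height of \<open>p\<close>. This is invariance of the horofunction at \<open>\<infinity>\<close>. The invariant quotient then
  turns proportional heights into proportional Euclidean distances.\<close>

lemma hyp_isometry_scales:
  assumes f: "hyp_isometry f"
    and q: "\<And>k. q k \<in> H4" "filterlim q at_infinity sequentially"
    and fq: "filterlim (\<lambda>k. f (q k)) at_infinity sequentially"
  obtains l where "l > 0" "\<And>p. p \<in> H4 \<Longrightarrow> snd (f p) = l * snd p"
    "\<And>p p'. p \<in> H4 \<Longrightarrow> p' \<in> H4 \<Longrightarrow> dist (f p) (f p') = l * dist p p'"
proof -
  define e :: hpoint where "e = (0, 1)"
  have e: "e \<in> H4" "f e \<in> H4" "snd e = 1"
    using hyp_isometryD(2)[OF f] by (auto simp: e_def H4_def)
  define l where "l = snd (f e)"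
  have l: "l > 0"
    using e by (auto simp: l_def H4_def)
  have snd_pos: "snd p > 0" if "p \<in> H4" for p
    using that by (auto simp: H4_def)
  have height: "snd (f p) = l * snd p" if p: "p \<in> H4" for p
  proof -
    have fp: "f p \<in> H4"
      using hyp_isometryD(2)[OF f p] .
    have lim: "(\<lambda>k. (dist (f p) (f (q k)) / dist (f e) (f (q k)))\<^sup>2) \<longlonglongrightarrow> 1\<^sup>2"
      by (intro tendsto_power dist_ratio_tendsto_1 fq)
    have lim': "(\<lambda>k. (dist p (q k) / dist e (q k))\<^sup>2 * (snd (f p) / (l * snd p))) \<longlonglongrightarrow> 1\<^sup>2 * (snd (f p) / (l * snd p))"
      by (intro tendsto_mult tendsto_power dist_ratio_tendsto_1 q tendsto_const)
    have ev: "\<forall>\<^sub>F k in sequentially. (dist p (q k) / dist e (q k))\<^sup>2 * (snd (f p) / (l * snd p))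
        = (dist (f p) (f (q k)) / dist (f e) (f (q k)))\<^sup>2"
    proof -
      have "\<forall>\<^sub>F k in sequentially. dist e (q k) > 0"
        using dist_filterlim_at_top[OF q(2)] unfolding filterlim_at_top_dense by blast
      then show ?thesis
      proof eventually_elim
        case (elim k)
        define s where "s = snd (q k)"
        define s' where "s' = snd (f (q k))"
        have pos: "s > 0" "s' > 0" "snd p > 0" "snd (f p) > 0"
          using snd_pos q(1) hyp_isometryD(2)[OF f] p by (auto simp: s_def s'_def)
        have 1: "(dist (f p) (f (q k)))\<^sup>2 = (dist p (q k))\<^sup>2 / (snd p * s) * (snd (f p) * s')"
          using hyp_isometry_dist[OF f p q(1)[of k]] pos by (simp add: s_def s'_def field_simps)
        have 2: "(dist (f e) (f (q k)))\<^sup>2 = (dist e (q k))\<^sup>2 / s * (l * s')"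
          using hyp_isometry_dist[OF f e(1) q(1)[of k]] pos l by (simp add: s_def s'_def l_def[symmetric] e(3) field_simps)
        show ?case
          unfolding power_divide 1 2 using pos l elim by (simp add: field_simps)
      qed
    qed
    have "1\<^sup>2 * (snd (f p) / (l * snd p)) = (1\<^sup>2 :: real)"
      by (rule LIMSEQ_unique[OF Lim_transform_eventually[OF lim' ev] lim])
    then show ?thesis
      using l snd_pos[OF p] by (simp add: field_simps)
  qed
  moreover have "dist (f p) (f p') = l * dist p p'" if p: "p \<in> H4" "p' \<in> H4" for p p'
  proof -
    have "(dist (f p) (f p'))\<^sup>2 = (l * dist p p')\<^sup>2"
      using hyp_isometry_dist[OF f p] snd_pos[OF p(1)] snd_pos[OF p(2)] l
      by (simp add: height p field_simps power2_eq_square)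
    then show ?thesis
      using l by (simp add: power2_eq_iff_nonneg)
  qed
  ultimately show thesis
    using l that by blast
qed

text \<open>The similarity of ratio \<open>l\<close> with linear part \<open>B\<close> that moves \<open>c\<close> by \<open>b\<close>. Every similarity has
  this form for every \<open>c\<close>; an adapted centre, such as a fixed point or a point of an axis, makes \<open>b\<close>
  simple.\<close>

definition sim :: "real^3 \<Rightarrow> real \<Rightarrow> real^3^3 \<Rightarrow> real^3 \<Rightarrow> hpoint \<Rightarrow> hpoint" where
  "sim c l B b = (\<lambda>p\<in>H4. (c + l *\<^sub>R (B *v (fst p - c)) + b, l * snd p))"

text \<open>Since heights scale by \<open>l\<close>, Pythagoras shows that the horizontal parts of distances scale
  by \<open>l\<close> as well. Points on one vertical line therefore have images on one vertical line, and \<open>f\<close>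
  induces a map of \<open>\<real>\<^sup>3\<close> scaling distances by \<open>l\<close>, which is affine.\<close>

lemma scaling_eq_sim:
  assumes f: "f \<in> extensional H4" and l: "l > 0"
    and height: "\<And>p. p \<in> H4 \<Longrightarrow> snd (f p) = l * snd p"
    and dist: "\<And>p p'. p \<in> H4 \<Longrightarrow> p' \<in> H4 \<Longrightarrow> dist (f p) (f p') = l * dist p p'"
  obtains B b where "orthogonal_matrix B" "f = sim c l B b"
proof -
  have d: "dist (fst (f p)) (fst (f p')) = l * dist (fst p) (fst p')" if p: "p \<in> H4" "p' \<in> H4" for p p'
  proof -
    have "(dist (f p) (f p'))\<^sup>2 = (l * dist p p')\<^sup>2"
      using dist[OF p] by simp
    then have "(dist (fst (f p)) (fst (f p')))\<^sup>2 + (dist (snd (f p)) (snd (f p')))\<^sup>2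
        = l\<^sup>2 * ((dist (fst p) (fst p'))\<^sup>2 + (dist (snd p) (snd p'))\<^sup>2)"
      by (simp add: dist_prod_def power_mult_distrib)
    moreover have "(dist (snd (f p)) (snd (f p')))\<^sup>2 = l\<^sup>2 * (dist (snd p) (snd p'))\<^sup>2"
      by (simp add: height p dist_real_def power2_eq_square algebra_simps)
    ultimately have "(dist (fst (f p)) (fst (f p')))\<^sup>2 = (l * dist (fst p) (fst p'))\<^sup>2"
      by (simp add: power_mult_distrib algebra_simps)
    then show ?thesis
      using l by (simp add: power2_eq_iff_nonneg)
  qed
  define \<phi> where "\<phi> v = fst (f (v, 1))" for v
  have \<phi>: "fst (f p) = \<phi> (fst p)" if "p \<in> H4" for p
    using d[OF that, of "(fst p, 1)"] by (simp add: \<phi>_def H4_def)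
  have \<phi>_dist: "dist (\<phi> v) (\<phi> w) = l * dist v w" for v w
    using d[of "(v, 1)" "(w, 1)"] by (simp add: \<phi>_def H4_def)
  define \<psi> where "\<psi> x = (1 / l) *\<^sub>R (\<phi> (c + x) - \<phi> c)" for x
  have "dist (\<psi> x) (\<psi> y) = dist x y" for x y
  proof -
    have "\<psi> x - \<psi> y = (1 / l) *\<^sub>R (\<phi> (c + x) - \<phi> (c + y))"
      by (simp add: \<psi>_def algebra_simps)
    then have "dist (\<psi> x) (\<psi> y) = (1 / l) * dist (\<phi> (c + x)) (\<phi> (c + y))"
      using l by (simp add: dist_norm)
    then show ?thesis
      using l by (simp add: \<phi>_dist)
  qed
  then have \<psi>: "orthogonal_transformation \<psi>"
    by (simp add: orthogonal_transformation_isometry \<psi>_def)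
  have \<psi>_mat: "matrix \<psi> *v x = \<psi> x" for x
    using \<psi> by (simp add: orthogonal_transformation_linear matrix_works)
  show thesis
  proof
    show "orthogonal_matrix (matrix \<psi>)"
      using \<psi> orthogonal_transformation_matrix by blast
    show "f = sim c l (matrix \<psi>) (\<phi> c - c)"
    proof (rule extensionalityI[OF f])
      show "sim c l (matrix \<psi>) (\<phi> c - c) \<in> extensional H4"
        by (simp add: sim_def)
      fix p assume p: "p \<in> H4"
      have "\<phi> (fst p) = c + l *\<^sub>R \<psi> (fst p - c) + (\<phi> c - c)"
        using l by (simp add: \<psi>_def)
      then show "f p = sim c l (matrix \<psi>) (\<phi> c - c) p"
        using p by (simp add: sim_def prod_eq_iff \<phi> \<psi>_mat height)
    qed
  qed
qed

lemma hyp_isometry_eq_sim: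
  assumes f: "hyp_isometry f"
    and q: "\<And>k. q k \<in> H4" "filterlim q at_infinity sequentially"
    and fq: "filterlim (\<lambda>k. f (q k)) at_infinity sequentially"
  obtains l B b where "l > 0" "orthogonal_matrix B" "f = sim c l B b"
proof -
  obtain l where l: "l > 0" "\<And>p. p \<in> H4 \<Longrightarrow> snd (f p) = l * snd p"
    "\<And>p p'. p \<in> H4 \<Longrightarrow> p' \<in> H4 \<Longrightarrow> dist (f p) (f p') = l * dist p p'"
    using hyp_isometry_scales[OF f q fq] by blast
  have "f \<in> extensional H4"
    using hyp_isometryD(1)[OF f] by (rule Bij_imp_extensional)
  from scaling_eq_sim[OF this l(1) l(2) l(3)] show thesis
    using that l(1) by metis
qed

lemma sim_in_H4: "l > 0 \<Longrightarrow> p \<in> H4 \<Longrightarrow> sim c l B b p \<in> H4"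
  by (auto simp: sim_def H4_def)

lemma sim_comp:
  assumes "l' > 0"
  shows "compose H4 (sim c l B b) (sim c l' B' b') = sim c (l * l') (B ** B') (b + l *\<^sub>R (B *v b'))"
proof
  fix p
  show "compose H4 (sim c l B b) (sim c l' B' b') p = sim c (l * l') (B ** B') (b + l *\<^sub>R (B *v b')) p"
  proof (cases "p \<in> H4")
    case True
    then have "sim c l' B' b' p \<in> H4"
      by (rule sim_in_H4[OF assms])
    then show ?thesis
      using True by (simp add: sim_def compose_def matrix_vector_right_distrib
        matrix_vector_mult_scaleR matrix_vector_mul_assoc[symmetric] algebra_simps)
  qed (simp add: sim_def compose_def)
qed

lemma sim_id: "sim c 1 (mat 1) 0 = (\<lambda>p\<in>H4. p)"
  by (auto simp: sim_def)

lemma sim_comp_inverse: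
  fixes c b
  assumes "l > 0" "orthogonal_matrix B"
  defines "g \<equiv> sim c (1 / l) (transpose B) (- (1 / l) *\<^sub>R (transpose B *v b))"
  shows "compose H4 (sim c l B b) g = (\<lambda>p\<in>H4. p)" "compose H4 g (sim c l B b) = (\<lambda>p\<in>H4. p)"
proof -
  have B: "B ** transpose B = mat 1" "transpose B ** B = mat 1"
    using assms(2) by (auto simp: orthogonal_matrix_def)
  have "B *v (- (1 / l) *\<^sub>R (transpose B *v b)) = - (1 / l) *\<^sub>R b"
    by (simp only: matrix_vector_mult_scaleR matrix_vector_mul_assoc B matrix_vector_mul_lid)
  then show "compose H4 (sim c l B b) g = (\<lambda>p\<in>H4. p)"
    unfolding g_def using assms(1) by (simp add: sim_comp B flip: sim_id[of c])
  show "compose H4 g (sim c l B b) = (\<lambda>p\<in>H4. p)"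
    unfolding g_def using assms(1) by (simp add: sim_comp B flip: sim_id[of c])
qed

lemma sim_1_eqD:
  assumes "sim c 1 W q = sim c 1 U p"
  shows "W = U" "q = p"
proof -
  have *: "W *v x + q = U *v x + p" for x
    using arg_cong[OF assms, of "\<lambda>f. fst (f (c + x, 1))"] by (simp add: sim_def H4_def)
  show "q = p"
    using *[of 0] by simp
  with * show "W = U"
    by (simp add: matrix_eq)
qed

lemma dist_sim:
  assumes "l > 0" "orthogonal_matrix B" "p \<in> H4" "q \<in> H4"
  shows "dist (sim c l B b p) (sim c l B b q) = l * dist p q"
proof -
  have n: "norm (B *v x) = norm x" for x
    using assms(2) orthogonal_transformation_matrix[of "(*v) B"] by (simp add: orthogonal_transformation_norm)
  have "(c + l *\<^sub>R (B *v (fst p - c)) + b) - (c + l *\<^sub>R (B *v (fst q - c)) + b) = l *\<^sub>R (B *v (fst p - fst q))"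
    by (simp add: matrix_vector_mult_diff_distrib algebra_simps)
  then have 1: "dist (fst (sim c l B b p)) (fst (sim c l B b q)) = l * dist (fst p) (fst q)"
    using assms by (simp add: sim_def dist_norm n)
  have 2: "dist (snd (sim c l B b p)) (snd (sim c l B b q)) = l * dist (snd p) (snd q)"
    using assms by (simp add: sim_def dist_real_def abs_mult flip: right_diff_distrib)
  show ?thesis
    unfolding dist_prod_def 1 2 using assms(1)
    by (simp add: power_mult_distrib real_sqrt_mult flip: distrib_left)
qed

lemma sim_fixes_infinity:
  assumes "l > 0" "orthogonal_matrix B"
  shows "boundary_maps_to (sim c l B b) Infinity_Pt Infinity_Pt"
proof -
  let ?f = "sim c l B b" and ?e = "(0, 1) :: hpoint"
  have "filterlim ?f at_infinity (inf at_infinity (principal H4))"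
    unfolding filterlim_at_infinity[OF order_refl] eventually_inf_principal eventually_at_infinity
  proof (intro allI impI)
    fix r :: real
    let ?R = "(r + norm (?f ?e)) / l + norm ?e"
    have "r \<le> norm (?f p)" if "p \<in> H4" "?R \<le> norm p" for p
    proof -
      have "l * dist p ?e = dist (?f p) (?f ?e)"
        using that(1) by (intro dist_sim[symmetric] assms) (auto simp: H4_def)
      also have "\<dots> \<le> norm (?f p) + norm (?f ?e)"
        by (simp add: dist_norm norm_triangle_ineq4)
      finally have "l * dist p ?e \<le> norm (?f p) + norm (?f ?e)" .
      moreover have "norm p - norm ?e \<le> dist p ?e"
        by (simp only: dist_norm norm_triangle_ineq2)
      then have "(r + norm (?f ?e)) / l \<le> dist p ?e"
        using that(2) by linarith
      then have "r + norm (?f ?e) \<le> l * dist p ?e"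
        using assms(1) by (simp add: pos_divide_le_eq mult.commute)
      ultimately show ?thesis by linarith
    qed
    then show "\<exists>R. \<forall>p. R \<le> norm p \<longrightarrow> p \<in> H4 \<longrightarrow> r \<le> norm (?f p)"
      by blast
  qed
  moreover have "filterlim ?f (principal H4) (inf at_infinity (principal H4))"
    using assms(1) by (auto simp: filterlim_principal eventually_inf_principal sim_in_H4)
  ultimately show ?thesis
    by (simp add: boundary_maps_to_def filterlim_inf)
qed

lemma fixes_infinity_sim:
  assumes "hyp_isometry f" "boundary_maps_to f Infinity_Pt Infinity_Pt"
  obtains l B b where "l > 0" "orthogonal_matrix B" "f = sim c l B b"
proof -
  define q :: "nat \<Rightarrow> hpoint" where "q k = (0, real (Suc k))" for k
  have q: "q k \<in> H4" for k
    by (simp add: q_def H4_def)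
  have "filterlim (\<lambda>k. norm (q k)) at_top sequentially"
    unfolding q_def norm_Pair
    using filterlim_compose[OF filterlim_real_sequentially filterlim_Suc] by (simp del: of_nat_Suc)
  then have lim: "filterlim q at_infinity sequentially"
    by (rule filterlim_norm_at_top_imp_at_infinity)
  then have "filterlim q (inf at_infinity (principal H4)) sequentially"
    by (simp add: filterlim_inf filterlim_principal q)
  then have "filterlim (\<lambda>k. f (q k)) (inf at_infinity (principal H4)) sequentially"
    using assms(2) unfolding boundary_maps_to_def boundary_filter.simps by (rule filterlim_compose[rotated])
  then have "filterlim (\<lambda>k. f (q k)) at_infinity sequentially"
    by (simp add: filterlim_inf)
  from hyp_isometry_eq_sim[OF assms(1) q lim this] show thesis
    using that by metis
qed

section \<open>Orthogonal matrices\<close>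

lemma norm_orthogonal_mult [simp]:
  fixes B :: "real^'n^'n"
  shows "orthogonal_matrix B \<Longrightarrow> norm (B *v x) = norm x"
  using orthogonal_transformation_matrix[of "(*v) B"] by (simp add: orthogonal_transformation_norm)

lemma inner_orthogonal_mult:
  fixes B :: "real^'n^'n"
  shows "orthogonal_matrix B \<Longrightarrow> (B *v x) \<bullet> (B *v y) = x \<bullet> y"
  using orthogonal_transformation_matrix[of "(*v) B"] by (simp add: orthogonal_transformation_def)

lemma orthogonal_mult_cancel:
  fixes B :: "real^'n^'n"
  assumes "orthogonal_matrix B"
  shows "B *v (transpose B *v x) = x" "transpose B *v (B *v x) = x"
  using assms by (simp_all only: matrix_vector_mul_assoc orthogonal_matrix_def matrix_vector_mul_lid)

lemma norm_orthogonal_matrix_le: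
  fixes B :: "real^'n^'n"
  assumes "orthogonal_matrix B"
  shows "norm B \<le> CARD('n)"
proof -
  have "norm (B $ i) = 1" for i
    using assms orthogonal_matrix_orthonormal_rows[of B] by (simp add: row_def)
  then show ?thesis
    using L2_set_le_sum[of UNIV "\<lambda>i. norm (B $ i)"] by (simp add: norm_vec_def)
qed

lemma tendsto_matrix_vector_mult:
  fixes f :: "'a \<Rightarrow> real^'n^'m"
  assumes "(f \<longlongrightarrow> A) F"
  shows "((\<lambda>n. f n *v x) \<longlongrightarrow> A *v x) F"
proof -
  have "linear (\<lambda>A :: real^'n^'m. A *v x)"
    by (rule linearI) (simp_all add: matrix_vector_mult_add_rdistrib scaleR_matrix_vector_assoc)
  then show ?thesis
    using bounded_linear.tendsto[OF _ assms] linear_conv_bounded_linear by blast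
qed

text \<open>If \<open>U\<^sup>2\<close> fixed a vector \<open>x\<close> outside \<open>\<real> a\<close>, it would fix \<open>a\<close>, \<open>x\<close> and, having determinant
  \<open>1\<close>, also their cross product; these span the space, so \<open>U\<^sup>2\<close> would be the identity.\<close>

lemma axis_of_rotation:
  fixes U :: "real^3^3"
  assumes U: "orthogonal_matrix U" "U *v a = a" "a \<noteq> 0" "U ** U \<noteq> mat 1"
    and x: "U *v (U *v x) = x"
  shows "x \<in> span {a}"
proof (rule ccontr)
  assume x': "x \<notin> span {a}"
  define n where "n = cross3 a x"
  define V where "V = U ** U"
  have V: "orthogonal_matrix V"
    using U(1) by (simp add: V_def orthogonal_matrix_mul)
  have "det V = det U * det U"
    by (simp add: V_def det_mul)
  then have det: "det V = 1"
    using det_orthogonal_matrix[OF U(1)] by auto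
  have Va: "V *v a = a" and Vx: "V *v x = x"
    using U x by (simp_all add: V_def flip: matrix_vector_mul_assoc)
  have Vn: "V *v n = n"
    using cross_orthogonal_matrix[OF V, of a x] det by (simp add: n_def Va Vx)
  have "n \<noteq> 0"
  proof
    assume "n = 0"
    then have "collinear {0, a, x}"
      by (simp add: n_def cross_eq_0)
    then obtain d where "x = d *\<^sub>R a"
      using U(3) by (metis collinear_lemma scaleR_zero_left)
    then show False
      using x' by (simp add: span_mul span_base)
  qed
  have "span {a, x, n} = UNIV"
  proof (rule ccontr)
    assume "span {a, x, n} \<noteq> UNIV"
    then obtain y where y: "y \<noteq> 0" "\<And>z. z \<in> span {a, x, n} \<Longrightarrow> y \<bullet> z = 0"
      using span_not_UNIV_orthogonal by metis
    then have y0: "y \<bullet> a = 0" "y \<bullet> x = 0" "y \<bullet> n = 0"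
      by (simp_all add: span_base)
    then have "cross3 y n = 0"
      unfolding n_def by (simp add: Lagrange)
    then have "(norm y)\<^sup>2 * (norm n)\<^sup>2 = 0"
      using y0(3) norm_cross[of y n] by simp
    then show False
      using y(1) \<open>n \<noteq> 0\<close> by simp
  qed
  moreover have "span {a, x, n} \<subseteq> {y. V *v y = y}"
    by (rule span_minimal)
      (auto simp: Va Vx Vn subspace_def matrix_vector_right_distrib matrix_vector_mult_scaleR)
  ultimately have "V = mat 1"
    by (auto simp: matrix_eq)
  then show False
    using U(4) by (simp add: V_def)
qed

text \<open>Let \<open>u x = U x + p\<close> be a screw motion with axis \<open>L = \<real> a\<close>, and \<open>w x = W x + q\<close>. The hypotheses
  say that \<open>w u w\<^sup>-\<^sup>1\<close> maps \<open>L\<close> to itself, and the conclusion says the same of \<open>w\<close>: the line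
  \<open>w\<^sup>-\<^sup>1 L\<close> is preserved by \<open>u\<close>, so its direction is an eigenvector of \<open>U\<close>, and the component of its
  position orthogonal to \<open>a\<close> is fixed by \<open>U\<close>. The eigenvalue may be \<open>-1\<close>, which is why the
  assumption concerns \<open>U\<^sup>2\<close>.\<close>

lemma preserves_axis_if_conjugate_preserves_axis:
  fixes U W :: "real^3^3"
  assumes U: "orthogonal_matrix U" "U *v a = a" "a \<noteq> 0" "U ** U \<noteq> mat 1"
    and W: "orthogonal_matrix W" and p: "p \<in> span {a}"
    and conj: "(W ** U ** transpose W) *v a \<in> span {a}"
      "q + W *v p - (W ** U ** transpose W) *v q \<in> span {a}"
  shows "W *v a \<in> span {a}" "q \<in> span {a}"
proof -
  note cancel = orthogonal_mult_cancel[OF W]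
  have WT: "orthogonal_matrix (transpose W)"
    using W by simp
  define y where "y = transpose W *v a"
  have Wy: "W *v y = a"
    by (simp only: y_def cancel)
  obtain k where "(W ** U ** transpose W) *v a = k *\<^sub>R a"
    using conj(1) by (auto simp: span_singleton)
  then have k: "W *v (U *v y) = k *\<^sub>R a"
    by (simp only: y_def matrix_vector_mul_assoc matrix_mul_assoc)
  then have Uy: "U *v y = k *\<^sub>R y"
    by (metis cancel(2) matrix_vector_mult_scaleR y_def)
  have ny: "norm y = norm a"
    unfolding y_def using WT by (rule norm_orthogonal_mult)
  have "\<bar>k\<bar> * norm y = norm y"
    using arg_cong[OF Uy, of norm] U(1) by simp
  then have "k = 1 \<or> k = -1"
    using ny U(3) by auto
  then have "k * k = 1"
    by auto
  then have "U *v (U *v y) = y"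
    by (simp add: Uy matrix_vector_mult_scaleR)
  then have "y \<in> span {a}"
    by (rule axis_of_rotation[OF U])
  then obtain d where d: "y = d *\<^sub>R a"
    by (auto simp: span_singleton)
  then have d0: "d \<noteq> 0"
    using ny U(3) by auto
  have "d *\<^sub>R (W *v a) = a"
    using Wy by (simp add: d matrix_vector_mult_scaleR)
  then have "(1 / d) *\<^sub>R (d *\<^sub>R (W *v a)) = (1 / d) *\<^sub>R a"
    by simp
  then have Wa: "W *v a = (1 / d) *\<^sub>R a"
    using d0 by simp
  then show "W *v a \<in> span {a}"
    by (simp add: span_mul span_base)
  have span_W: "W *v x \<in> span {a}" if "x \<in> span {a}" for x
    using that Wa by (auto simp: span_singleton matrix_vector_mult_scaleR)
  define x where "x = transpose W *v q"
  have q: "q = W *v x"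
    by (simp only: x_def cancel)
  have "q + W *v p - (W ** U ** transpose W) *v q - W *v p \<in> span {a}"
    using conj(2) span_W[OF p] by (rule span_diff)
  moreover have "(W ** U ** transpose W) *v q = W *v (U *v x)"
    by (simp only: x_def matrix_vector_mul_assoc matrix_mul_assoc)
  ultimately have "W *v (x - U *v x) \<in> span {a}"
    by (simp add: q matrix_vector_mult_diff_distrib)
  then obtain e where "W *v (x - U *v x) = e *\<^sub>R a"
    by (auto simp: span_singleton)
  then have e: "x - U *v x = (e * d) *\<^sub>R a"
    by (metis cancel(2) matrix_vector_mult_scaleR y_def d scaleR_scaleR)
  \<comment> \<open>\<open>x - U x\<close> is parallel to \<open>a\<close> and orthogonal to it.\<close>
  have "(x - U *v x) \<bullet> a = x \<bullet> a - (U *v x) \<bullet> (U *v a)"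
    by (simp add: inner_diff_left U(2))
  then have "(x - U *v x) \<bullet> a = 0"
    by (simp add: inner_orthogonal_mult[OF U(1)])
  then have "x - U *v x = 0"
    using U(3) by (simp add: e)
  then have "U *v (U *v x) = x"
    by simp
  then have "x \<in> span {a}"
    by (rule axis_of_rotation[OF U])
  then show "q \<in> span {a}"
    unfolding q by (rule span_W)
qed

text \<open>The componentwise power occupies the notation \<open>^\<close> on matrices.\<close>

abbreviation matpow :: "real^'n^'n \<Rightarrow> nat \<Rightarrow> real^'n^'n" where
  "matpow A n \<equiv> ((**) A ^^ n) (mat 1)"

lemma matpow_add: "matpow A (m + n) = matpow A m ** matpow A n"
  by (induction m) (simp_all add: matrix_mul_assoc)

lemma orthogonal_matpow: "orthogonal_matrix A \<Longrightarrow> orthogonal_matrix (matpow A n)"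
  by (induction n) (simp_all add: orthogonal_matrix_id orthogonal_matrix_mul)

lemma matpow_fixes: "A *v a = a \<Longrightarrow> matpow A n *v a = a"
  by (induction n) (simp_all flip: matrix_vector_mul_assoc)

lemma matpow_conj:
  assumes "orthogonal_matrix C"
  shows "matpow (transpose C ** A ** C) n = transpose C ** matpow A n ** C"
proof (induction n)
  case 0
  then show ?case
    using assms by (simp add: orthogonal_matrix_def)
next
  case (Suc n)
  have "transpose C ** A ** C ** (transpose C ** matpow A n ** C)
      = transpose C ** A ** (C ** transpose C) ** matpow A n ** C"
    by (simp only: matrix_mul_assoc)
  also have "C ** transpose C = mat 1"
    using assms by (simp add: orthogonal_matrix_def)
  finally show ?case
    by (simp add: Suc matrix_mul_assoc)
qed

lemma infinite_order_conj:
  assumes "orthogonal_matrix C" "infinite_order A"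
  shows "infinite_order (transpose C ** A ** C)"
  unfolding infinite_order_def
proof (intro allI impI notI)
  fix n :: nat
  assume n: "n > 0" and "matpow (transpose C ** A ** C) n = mat 1"
  then have "C ** (transpose C ** matpow A n ** C) ** transpose C = C ** mat 1 ** transpose C"
    using matpow_conj[OF assms(1)] by metis
  then have "(C ** transpose C) ** matpow A n ** (C ** transpose C) = C ** transpose C"
    by (simp only: matrix_mul_assoc matrix_mul_rid)
  then show False
    using assms n by (simp add: orthogonal_matrix_def infinite_order_def)
qed

lemma norm_matrix_vector_mult_le:
  fixes M :: "real^'n^'m"
  shows "norm (M *v x) \<le> CARD('m) * norm M * norm x"
proof -
  have "norm (M *v x) \<le> (\<Sum>i\<in>UNIV. \<bar>(M *v x) $ i\<bar>)"
    by (rule norm_le_l1_cart)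
  also have "\<dots> \<le> (\<Sum>i\<in>(UNIV :: 'm set). norm M * norm x)"
  proof (rule sum_mono)
    fix i
    have "\<bar>(M *v x) $ i\<bar> = \<bar>M $ i \<bullet> x\<bar>"
      by (simp add: matrix_mult_dot)
    also have "\<dots> \<le> norm (M $ i) * norm x"
      by (rule Cauchy_Schwarz_ineq2)
    also have "\<dots> \<le> norm M * norm x"
      by (intro mult_right_mono Finite_Cartesian_Product.norm_nth_le) auto
    finally show "\<bar>(M *v x) $ i\<bar> \<le> norm M * norm x" .
  qed
  finally show ?thesis
    by (simp add: mult.assoc)
qed

text \<open>The powers of \<open>A\<close> lie in a compact set, so two of them, \<open>A\<^sup>i\<close> and \<open>A\<^sup>j\<close> with \<open>i < j\<close>, are
  close together; then \<open>A\<^bsup>j-i\<^esup>\<close> is close to the identity.\<close>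

lemma matpow_near_identity:
  fixes A :: "real^'n^'n"
  assumes A: "orthogonal_matrix A" and "\<epsilon> > 0"
  obtains n where "n > 0" "\<And>x. norm (matpow A n *v x - x) \<le> \<epsilon> * norm x"
proof -
  have "bounded (range (matpow A))"
    by (rule boundedI[of _ "CARD('n)"]) (auto intro: norm_orthogonal_matrix_le orthogonal_matpow A)
  then obtain L r where r: "strict_mono r" and "(matpow A \<circ> r) \<longlonglongrightarrow> L"
    using bounded_imp_convergent_subsequence by blast
  then have "Cauchy (matpow A \<circ> r)"
    using LIMSEQ_imp_Cauchy by blast
  then obtain M where M: "\<And>m n. m \<ge> M \<Longrightarrow> n \<ge> M \<Longrightarrow> dist (matpow A (r m)) (matpow A (r n)) < \<epsilon> / CARD('n)"
    using assms(2) unfolding Cauchy_def o_def by (metis zero_less_divide_iff of_nat_0_less_iff zero_less_card_finite)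
  define n where "n = r (Suc M) - r M"
  have rM: "r M < r (Suc M)"
    using r by (simp add: strict_mono_def)
  show thesis
  proof
    show "n > 0"
      using rM by (simp add: n_def)
    fix x
    have "matpow A (r (Suc M)) = matpow A (r M) ** matpow A n"
      using rM by (simp add: n_def flip: matpow_add)
    then have "(matpow A (r (Suc M)) - matpow A (r M)) *v x = matpow A (r M) *v (matpow A n *v x - x)"
      by (simp add: matrix_vector_mult_diff_rdistrib matrix_vector_mult_diff_distrib matrix_vector_mul_assoc)
    then have "norm (matpow A n *v x - x) = norm ((matpow A (r (Suc M)) - matpow A (r M)) *v x)"
      by (simp add: orthogonal_matpow A)
    also have "\<dots> \<le> CARD('n) * norm (matpow A (r (Suc M)) - matpow A (r M)) * norm x"
      by (rule norm_matrix_vector_mult_le)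
    also have "\<dots> \<le> CARD('n) * (\<epsilon> / CARD('n)) * norm x"
      using M[of "Suc M" M] by (intro mult_right_mono mult_left_mono) (auto simp: dist_norm)
    finally show "norm (matpow A n *v x - x) \<le> \<epsilon> * norm x"
      by simp
  qed
qed

section \<open>Discrete groups of similarities acting freely\<close>

text \<open>Discreteness enters only through the sequential condition \<open>isolated\<close>, with pointwise
  convergence.\<close>

locale discrete_similarity_group =
  fixes G :: "(hpoint \<Rightarrow> hpoint) set"
  assumes similarity: "f \<in> G \<Longrightarrow> \<exists>l B b. l > 0 \<and> orthogonal_matrix B \<and> f = sim c l B b"
    and comp: "f \<in> G \<Longrightarrow> g \<in> G \<Longrightarrow> compose H4 f g \<in> G"
    and inverse: "sim c l B b \<in> G \<Longrightarrow> l > 0 \<Longrightarrow> orthogonal_matrix B \<Longrightarrow>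
      sim c (1 / l) (transpose B) (- (1 / l) *\<^sub>R (transpose B *v b)) \<in> G"
    and isolated: "(\<And>n. F n \<in> G) \<Longrightarrow> g \<in> G \<Longrightarrow> (\<And>p. p \<in> H4 \<Longrightarrow> (\<lambda>n. F n p) \<longlonglongrightarrow> g p)
      \<Longrightarrow> \<forall>\<^sub>F n in sequentially. F n = g"
    and free: "f \<in> G \<Longrightarrow> p \<in> H4 \<Longrightarrow> f p = p \<Longrightarrow> f = (\<lambda>p\<in>H4. p)"
begin

text \<open>Infinitely many such isometries would contain a sequence of distinct ones, \<open>\<gamma> n\<close>, that
  converges pointwise, because their linear parts and displacements lie in a compact set. The limit need
  not belong to the group, but \<open>\<gamma> (n + 1)\<^sup>-\<^sup>1 \<gamma> n\<close> converges to the identity, which does; so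
  \<open>\<gamma> n = \<gamma> (n + 1)\<close> for large \<open>n\<close>.\<close>

lemma finite_bounded_isometries:
  "finite {f \<in> G. \<exists>B b. orthogonal_matrix B \<and> norm b \<le> R \<and> f = sim c 1 B b}" (is "finite ?S")
proof (rule ccontr)
  assume "infinite ?S"
  then obtain \<gamma> :: "nat \<Rightarrow> _" where \<gamma>: "inj \<gamma>" "range \<gamma> \<subseteq> ?S"
    by (meson infinite_countable_subset)
  then have "\<forall>n. \<exists>B b. orthogonal_matrix B \<and> norm b \<le> R \<and> \<gamma> n = sim c 1 B b"
    by blast
  then obtain B b where Bb: "\<And>n. orthogonal_matrix (B n)" "\<And>n. norm (b n) \<le> R" "\<And>n. \<gamma> n = sim c 1 (B n) (b n)"
    by metis
  have \<gamma>G: "\<gamma> n \<in> G" for n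
    using \<gamma>(2) by blast
  have "norm (B n, b n) \<le> 3 + R" for n
    using norm_Pair_le[of "B n" "b n"] Bb(2)[of n] norm_orthogonal_matrix_le[OF Bb(1)[of n]] by simp
  then have "bounded (range (\<lambda>n. (B n, b n)))"
    by (auto intro!: boundedI)
  then obtain L r where r: "strict_mono r" and L: "((\<lambda>n. (B n, b n)) \<circ> r) \<longlonglongrightarrow> L"
    using bounded_imp_convergent_subsequence by blast
  have LB: "(\<lambda>n. B (r n)) \<longlonglongrightarrow> fst L" and Lb: "(\<lambda>n. b (r n)) \<longlonglongrightarrow> snd L"
    using tendsto_fst[OF L] tendsto_snd[OF L] by (simp_all add: o_def)
  have conv: "(\<lambda>n. \<gamma> (r n) p) \<longlonglongrightarrow> sim c 1 (fst L) (snd L) p" if "p \<in> H4" for p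
    using that unfolding Bb(3) sim_def
    by (auto intro!: tendsto_intros LB Lb tendsto_matrix_vector_mult)
  define \<iota> where "\<iota> n = sim c (1 / 1) (transpose (B (r (Suc n)))) (- (1 / 1) *\<^sub>R (transpose (B (r (Suc n))) *v b (r (Suc n))))" for n
  have \<iota>G: "\<iota> n \<in> G" for n
    unfolding \<iota>_def using \<gamma>G[of "r (Suc n)"] Bb(1)[of "r (Suc n)"] by (intro inverse) (simp_all flip: Bb(3))
  have \<iota>\<gamma>: "\<iota> n (\<gamma> (r (Suc n)) p) = p" if "p \<in> H4" for n p
    using fun_cong[OF sim_comp_inverse(2)[of 1 "B (r (Suc n))" c "b (r (Suc n))"], of p] that Bb(1)
    by (simp add: \<iota>_def Bb(3) compose_def)
  have "\<forall>\<^sub>F n in sequentially. compose H4 (\<iota> n) (\<gamma> (r n)) = sim c 1 (mat 1) 0"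
  proof (rule isolated)
    show "compose H4 (\<iota> n) (\<gamma> (r n)) \<in> G" for n
      by (intro comp \<iota>G \<gamma>G)
    show "sim c 1 (mat 1) 0 \<in> G"
    proof -
      have "compose H4 (\<iota> 0) (\<gamma> (r (Suc 0))) = (\<lambda>p\<in>H4. p)"
        unfolding \<iota>_def Bb(3) by (rule sim_comp_inverse(2)) (use Bb(1) in auto)
      then show ?thesis
        using comp[OF \<iota>G[of 0] \<gamma>G[of "r (Suc 0)"]] by (simp only: sim_id)
    qed
    fix p assume p: "p \<in> H4"
    have "dist (compose H4 (\<iota> n) (\<gamma> (r n)) p) p = dist (\<gamma> (r n) p) (\<gamma> (r (Suc n)) p)" for n
    proof -
      have "\<gamma> m p \<in> H4" for m
        using p by (simp add: Bb(3) sim_in_H4)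
      then have "dist (\<iota> n (\<gamma> (r n) p)) (\<iota> n (\<gamma> (r (Suc n)) p)) = 1 / 1 * dist (\<gamma> (r n) p) (\<gamma> (r (Suc n)) p)"
        unfolding \<iota>_def by (intro dist_sim) (use Bb(1) in auto)
      then show ?thesis
        using p by (simp add: \<iota>\<gamma> compose_eq)
    qed
    moreover have "(\<lambda>n. dist (\<gamma> (r n) p) (\<gamma> (r (Suc n)) p)) \<longlonglongrightarrow> dist (sim c 1 (fst L) (snd L) p) (sim c 1 (fst L) (snd L) p)"
      by (intro tendsto_dist conv[OF p] LIMSEQ_Suc[OF conv[OF p]])
    ultimately have "(\<lambda>n. compose H4 (\<iota> n) (\<gamma> (r n)) p) \<longlonglongrightarrow> p"
      by (subst tendsto_dist_iff) simp
    then show "(\<lambda>n. compose H4 (\<iota> n) (\<gamma> (r n)) p) \<longlonglongrightarrow> sim c 1 (mat 1) 0 p"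
      using p by (simp add: sim_id)
  qed
  then obtain n where n: "compose H4 (\<iota> n) (\<gamma> (r n)) = (\<lambda>p\<in>H4. p)"
    unfolding sim_id eventually_sequentially by blast
  have "\<gamma> (r n) = \<gamma> (r (Suc n))"
  proof
    fix p
    show "\<gamma> (r n) p = \<gamma> (r (Suc n)) p"
    proof (cases "p \<in> H4")
      case True
      have in_H4: "\<gamma> m p \<in> H4" for m
        using True by (simp add: Bb(3) sim_in_H4)
      have "dist (\<iota> n (\<gamma> (r n) p)) (\<iota> n (\<gamma> (r (Suc n)) p)) = 1 / 1 * dist (\<gamma> (r n) p) (\<gamma> (r (Suc n)) p)"
        unfolding \<iota>_def by (intro dist_sim in_H4) (use Bb(1) in auto)
      moreover have "\<iota> n (\<gamma> (r n) p) = p"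
        using fun_cong[OF n, of p] True by (simp add: compose_eq)
      ultimately show ?thesis
        using True by (simp add: \<iota>\<gamma>)
    qed (simp add: Bb(3) sim_def)
  qed
  then show False
    using \<gamma>(1) r by (metis injD lessI less_irrefl strict_monoD)
qed

text \<open>The ratio is visible on heights, which do not depend on the centre.\<close>

lemma isometry_recenter:
  assumes "sim c' 1 A a \<in> G"
  obtains B b where "orthogonal_matrix B" "sim c' 1 A a = sim c 1 B b"
proof -
  obtain l B b where *: "orthogonal_matrix B" "sim c' 1 A a = sim c l B b"
    using similarity[OF assms, of c] by metis
  from arg_cong[OF *(2), of "\<lambda>f. snd (f (c, 1))"] have "l = 1"
    by (simp add: sim_def H4_def)
  with * that show thesis by blast
qed

text \<open>Let \<open>v\<close> be the fixed point of the contraction \<open>f\<close> in \<open>\<real>\<^sup>3\<close>, which exists by Banach's theorem.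
  The isometries \<open>f\<^sup>n g f\<^sup>-\<^sup>n\<close> move \<open>v\<close> by \<open>l\<^sup>n\<close> times the amount by which \<open>g\<close> moves it. That amount
  is nonzero by freeness, so they are pairwise distinct, but there can be only finitely many of them.\<close>

lemma no_contraction:
  assumes g: "sim c' 1 A a \<in> G" "sim c' 1 A a \<noteq> (\<lambda>p\<in>H4. p)"
    and f: "sim c l B b \<in> G" "0 < l" "orthogonal_matrix B"
  shows "\<not> l < 1"
proof
  assume l1: "l < 1"
  have "\<exists>!v. c + l *\<^sub>R (B *v (v - c)) + b = v"
  proof (rule banach_fix_type[where c = l], goal_cases)
    case 3
    have "dist (c + l *\<^sub>R (B *v (x - c)) + b) (c + l *\<^sub>R (B *v (y - c)) + b) \<le> l * dist x y" for x y
    proof -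
      have "(c + l *\<^sub>R (B *v (x - c)) + b) - (c + l *\<^sub>R (B *v (y - c)) + b) = l *\<^sub>R (B *v (x - y))"
        by (simp add: matrix_vector_mult_diff_distrib algebra_simps)
      then show ?thesis
        using f(2,3) by (simp add: dist_norm)
    qed
    then show ?case by blast
  qed (use f(2) l1 in auto)
  then obtain v where v: "c + l *\<^sub>R (B *v (v - c)) + b = v"
    by blast
  obtain l' C d where C: "orthogonal_matrix C" "sim c l B b = sim v l' C d"
    using similarity[OF f(1), of v] by metis
  have "l' = l"
    using arg_cong[OF C(2), of "\<lambda>f. snd (f (v, 1))"] by (simp add: sim_def H4_def)
  moreover have "d = 0"
    using arg_cong[OF C(2), of "\<lambda>f. fst (f (v, 1))"] v by (simp add: sim_def H4_def)
  ultimately have fv: "sim v l C 0 \<in> G"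
    using f(1) C(2) by simp
  have fv': "sim v (1 / l) (transpose C) 0 \<in> G"
    using inverse[OF fv f(2) C(1)] by simp
  obtain E e where E: "orthogonal_matrix E" "sim c' 1 A a = sim v 1 E e"
    using isometry_recenter[OF g(1)] .
  have "e \<noteq> 0"
  proof
    assume "e = 0"
    then have "sim v 1 E e (v, 1) = (v, 1)" "(v, 1) \<in> H4"
      by (simp_all add: sim_def H4_def)
    then show False
      using free[of "sim v 1 E e" "(v, 1)"] g E(2) by simp
  qed
  define \<gamma> where "\<gamma> n = ((\<lambda>h. compose H4 (compose H4 (sim v l C 0) h) (sim v (1 / l) (transpose C) 0)) ^^ n) (sim v 1 E e)" for n
  have \<gamma>: "\<gamma> n \<in> G \<and> (\<exists>D d. orthogonal_matrix D \<and> norm d = l ^ n * norm e \<and> \<gamma> n = sim v 1 D d)" for n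
  proof (induction n)
    case 0
    then show ?case
      using E g by (auto simp: \<gamma>_def)
  next
    case (Suc n)
    then obtain D d where D: "orthogonal_matrix D" "norm d = l ^ n * norm e" "\<gamma> n = sim v 1 D d" "\<gamma> n \<in> G"
      by blast
    have "\<gamma> (Suc n) = compose H4 (compose H4 (sim v l C 0) (\<gamma> n)) (sim v (1 / l) (transpose C) 0)"
      by (simp add: \<gamma>_def)
    moreover have "compose H4 (compose H4 (sim v l C 0) (\<gamma> n)) (sim v (1 / l) (transpose C) 0)
        = sim v 1 (C ** D ** transpose C) (l *\<^sub>R (C *v d))"
      using f(2) by (simp add: D(3) sim_comp)
    moreover have "orthogonal_matrix (C ** D ** transpose C)"
      using C(1) D(1) by (simp add: orthogonal_matrix_mul)
    moreover have "norm (l *\<^sub>R (C *v d)) = l ^ Suc n * norm e"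
      using C(1) D(2) f(2) by simp
    moreover have "compose H4 (compose H4 (sim v l C 0) (\<gamma> n)) (sim v (1 / l) (transpose C) 0) \<in> G"
      by (intro comp fv fv' D(4))
    ultimately show ?case by metis
  qed
  have "range \<gamma> \<subseteq> {f \<in> G. \<exists>B b. orthogonal_matrix B \<and> norm b \<le> norm e \<and> f = sim v 1 B b}"
  proof safe
    fix n
    obtain D d where D: "orthogonal_matrix D" "norm d = l ^ n * norm e" "\<gamma> n = sim v 1 D d"
      using \<gamma> by metis
    have "norm d \<le> norm e"
      unfolding D(2) using f(2) l1 by (intro mult_left_le_one_le) (auto intro: power_le_one)
    with D show "\<exists>B b. orthogonal_matrix B \<and> norm b \<le> norm e \<and> \<gamma> n = sim v 1 B b"
      by blast
  qed (use \<gamma> in blast)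
  then have "finite (range \<gamma>)"
    using finite_bounded_isometries finite_subset by blast
  then have "\<not> inj \<gamma>"
    using finite_imageD infinite_UNIV_nat by blast
  then obtain m n where mn: "m \<noteq> n" "\<gamma> m = \<gamma> n"
    by (auto simp: inj_def)
  have "norm (fst (\<gamma> n (v, 1)) - v) = l ^ n * norm e" for n
  proof -
    obtain D d where "norm d = l ^ n * norm e" "\<gamma> n = sim v 1 D d"
      using \<gamma> by metis
    then show ?thesis
      by (simp add: sim_def H4_def)
  qed
  then have "l ^ m * norm e = l ^ n * norm e"
    using mn(2) by metis
  then have "l ^ m = l ^ n"
    using \<open>e \<noteq> 0\<close> by simp
  then show False
    using mn(1) f(2) l1 by (metis linorder_neqE_nat order_less_irrefl power_strict_decreasing)
qed

text \<open>Neither an element nor its inverse is a contraction, so the ratio is \<open>1\<close>.\<close>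

lemma isometries_if_isometry:
  assumes g: "sim c' 1 A a \<in> G" "sim c' 1 A a \<noteq> (\<lambda>p\<in>H4. p)" and f: "f \<in> G"
  obtains B b where "orthogonal_matrix B" "f = sim c 1 B b"
proof -
  obtain l B b where B: "l > 0" "orthogonal_matrix B" "f = sim c l B b"
    using similarity[OF f, of c] by metis
  have "\<not> l < 1"
    using no_contraction[OF g] f B by blast
  moreover have "\<not> 1 / l < 1"
    using no_contraction[OF g inverse[of c l B b]] f B by simp
  ultimately have "l = 1"
    using B(1) by (simp add: field_simps)
  with B that show thesis by blast
qed

text \<open>The iteration \<open>w\<^sub>0 = f\<close>, \<open>w\<^bsub>k+1\<^esub> = w\<^sub>k u w\<^sub>k\<^sup>-\<^sup>1\<close> converges to \<open>u\<close> whatever \<open>f\<close> is. For the linear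
  parts this rests on the identity \<open>W U - U W = (W - U) (U - 1) - (U - 1) (W - U)\<close>: as \<open>U - 1\<close> has
  norm at most \<open>1/10\<close>, each step shrinks the distance of \<open>W\<close> to \<open>U\<close> by a factor \<open>5\<close>. By discreteness
  the sequence reaches \<open>u\<close>, which preserves the axis, and
  \<open>preserves_axis_if_conjugate_preserves_axis\<close> carries this back to \<open>w\<^sub>0\<close>.\<close>

lemma preserves_axis_of_screw:
  assumes u: "sim c 1 U p \<in> G" "orthogonal_matrix U" "U *v a = a" "a \<noteq> 0" "U ** U \<noteq> mat 1"
      "p \<in> span {a}"
    and near: "\<And>x. norm (U *v x - x) \<le> 1 / 10 * norm x"
    and f: "sim c 1 B b \<in> G" "orthogonal_matrix B"
  shows "B *v a \<in> span {a} \<and> b \<in> span {a}"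
proof -
  \<comment> \<open>Linear part and displacement of \<open>w u w\<^sup>-\<^sup>1\<close>, where \<open>w\<close> has linear part \<open>W\<close> and displacement \<open>q\<close>.\<close>
  define F where "F k = ((\<lambda>(W, q). (W ** U ** transpose W, q + W *v p - (W ** U ** transpose W) *v q)) ^^ k) (B, b)" for k
  define W where "W k = fst (F k)" for k
  define q where "q k = snd (F k)" for k
  have W0: "W 0 = B" and q0: "q 0 = b"
    by (simp_all add: W_def q_def F_def)
  have WS: "W (Suc k) = W k ** U ** transpose (W k)"
    and qS: "q (Suc k) = q k + W k *v p - W (Suc k) *v q k" for k
    by (simp_all add: W_def q_def F_def split_beta)
  have W: "orthogonal_matrix (W k)" for k
    by (induction k) (simp_all add: W0 WS f u orthogonal_matrix_mul)
  have inG: "sim c 1 (W k) (q k) \<in> G" for k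
  proof (induction k)
    case (Suc k)
    let ?w = "sim c 1 (W k) (q k)"
    let ?w' = "sim c (1 / 1) (transpose (W k)) (- (1 / 1) *\<^sub>R (transpose (W k) *v q k))"
    have "?w' \<in> G"
      using inverse[OF Suc] W by simp
    then have "compose H4 (compose H4 ?w (sim c 1 U p)) ?w' \<in> G"
      by (intro comp Suc u)
    moreover have "(W k ** U) *v (- (1 / 1) *\<^sub>R (transpose (W k) *v q k)) = - (W (Suc k) *v q k)"
      unfolding matrix_vector_mult_scaleR matrix_vector_mul_assoc WS by simp
    then have "compose H4 (compose H4 ?w (sim c 1 U p)) ?w' = sim c 1 (W (Suc k)) (q (Suc k))"
      by (simp only: sim_comp zero_less_one div_by_1 qS) (simp add: WS)
    ultimately show ?case by simp
  qed (simp add: W0 q0 f)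
  have near_conj: "norm (x - W (Suc k) *v x) \<le> 1 / 10 * norm x" for k x
  proof -
    have "x - W (Suc k) *v x = W k *v (transpose (W k) *v x - U *v (transpose (W k) *v x))"
      unfolding WS matrix_vector_mult_diff_distrib matrix_vector_mul_assoc[symmetric] orthogonal_mult_cancel[OF W] ..
    then have "norm (x - W (Suc k) *v x) = norm (U *v (transpose (W k) *v x) - transpose (W k) *v x)"
      by (simp only: norm_orthogonal_mult[OF W] norm_minus_commute)
    also have "\<dots> \<le> 1 / 10 * norm (transpose (W k) *v x)"
      by (rule near)
    also have "norm (transpose (W k) *v x) = norm x"
      using W by (intro norm_orthogonal_mult) simp
    finally show ?thesis .
  qed
  \<comment> \<open>At \<open>k = 0\<close> the factor \<open>2\<close> bounds the difference of any two orthogonal maps.\<close>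
  have W_U: "norm (W k *v x - U *v x) \<le> 2 * (1 / 5) ^ k * norm x" for k x
  proof (induction k arbitrary: x)
    case 0
    show ?case
      using norm_triangle_ineq4[of "W 0 *v x" "U *v x"] W u(2) by simp
  next
    case (Suc k)
    define y where "y = transpose (W k) *v x"
    have ny: "norm y = norm x"
      unfolding y_def using W by (intro norm_orthogonal_mult) simp
    have x: "x = W k *v y"
      by (simp only: y_def orthogonal_mult_cancel[OF W])
    define z where "z = W k *v y - U *v y"
    have "W (Suc k) *v x - U *v x = W k *v (U *v y) - U *v (W k *v y)"
      unfolding WS y_def matrix_vector_mul_assoc[symmetric] orthogonal_mult_cancel[OF W] ..
    also have "\<dots> = (W k *v (U *v y - y) - U *v (U *v y - y)) - (U *v z - z)"
      by (simp add: z_def matrix_vector_mult_diff_distrib)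
    finally have "norm (W (Suc k) *v x - U *v x) \<le> norm (W k *v (U *v y - y) - U *v (U *v y - y)) + norm (U *v z - z)"
      by (simp only: norm_triangle_ineq4)
    also have "\<dots> \<le> 2 * (1 / 5) ^ k * (1 / 10 * norm y) + 1 / 10 * (2 * (1 / 5) ^ k * norm y)"
    proof (rule add_mono)
      have "norm (W k *v (U *v y - y) - U *v (U *v y - y)) \<le> 2 * (1 / 5) ^ k * norm (U *v y - y)"
        by (rule Suc)
      also have "\<dots> \<le> 2 * (1 / 5) ^ k * (1 / 10 * norm y)"
        using near by (intro mult_left_mono) auto
      finally show "norm (W k *v (U *v y - y) - U *v (U *v y - y)) \<le> 2 * (1 / 5) ^ k * (1 / 10 * norm y)" .
      have "norm (U *v z - z) \<le> 1 / 10 * norm z"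
        by (rule near)
      also have "\<dots> \<le> 1 / 10 * (2 * (1 / 5) ^ k * norm y)"
        unfolding z_def using Suc by (intro mult_left_mono) auto
      finally show "norm (U *v z - z) \<le> 1 / 10 * (2 * (1 / 5) ^ k * norm y)" .
    qed
    finally show ?case
      by (simp add: ny algebra_simps)
  qed
  \<comment> \<open>The displacements satisfy \<open>q' - p = (1 - W') (q - p) + (W - W') p\<close> with \<open>W'\<close> and \<open>q'\<close> belonging
    to the next step. The first term is at most a tenth of \<open>q - p\<close>; the multiple of \<open>norm p\<close>
    in \<open>C\<close> is large enough to absorb the second.\<close>
  define C where "C = norm (b - p) + 10 * norm p"
  have q_p: "norm (q k - p) \<le> C * (1 / 2) ^ k" for k
  proof (induction k)
    case 0
    show ?case by (simp add: q0 C_def)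
  next
    case (Suc k)
    let ?d = "q k - p"
    have "(1 / 5) ^ k \<le> (1 / 2 :: real) ^ k"
      by (rule power_mono) auto
    then have pow: "(1 / 5) ^ k * norm p \<le> (1 / 2) ^ k * norm p"
      by (rule mult_right_mono) simp
    have "q (Suc k) - p = (?d - W (Suc k) *v ?d) + ((W k *v p - U *v p) - (W (Suc k) *v p - U *v p))"
      by (simp add: qS matrix_vector_mult_diff_distrib)
    also have "norm \<dots> \<le> norm (?d - W (Suc k) *v ?d) + (norm (W k *v p - U *v p) + norm (W (Suc k) *v p - U *v p))"
      by (rule order_trans[OF norm_triangle_ineq add_left_mono[OF norm_triangle_ineq4]])
    also have "\<dots> \<le> 1 / 10 * norm ?d + (2 * (1 / 5) ^ k * norm p + 2 * (1 / 5) ^ Suc k * norm p)"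
      by (intro add_mono near_conj W_U)
    also have "\<dots> \<le> 1 / 10 * (C * (1 / 2) ^ k) + 4 * ((1 / 2) ^ k * norm p)"
    proof -
      have "2 * (1 / 5) ^ k * norm p + 2 * (1 / 5) ^ Suc k * norm p = 12 / 5 * ((1 / 5) ^ k * norm p)"
        by simp
      moreover have "0 \<le> (1 / 2) ^ k * norm p"
        by simp
      ultimately show ?thesis
        using Suc pow by linarith
    qed
    also have "4 * ((1 / 2) ^ k * norm p) \<le> 4 / 10 * (C * (1 / 2) ^ k)"
      by (simp add: C_def)
    finally show ?case
      by simp
  qed
  have "\<forall>\<^sub>F k in sequentially. sim c 1 (W k) (q k) = sim c 1 U p"
  proof (rule isolated[OF inG u(1)])
    fix x assume x: "x \<in> H4"
    have "(\<lambda>k. W k *v y - U *v y) \<longlonglongrightarrow> 0" for y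
    proof (rule Lim_null_comparison)
      show "\<forall>\<^sub>F k in sequentially. norm (W k *v y - U *v y) \<le> 2 * (1 / 5) ^ k * norm y"
        using W_U by simp
      show "(\<lambda>k. 2 * (1 / 5) ^ k * norm y) \<longlonglongrightarrow> 0"
        by (intro tendsto_mult_left_zero tendsto_mult_right_zero LIMSEQ_realpow_zero) auto
    qed
    then have Wl: "(\<lambda>k. W k *v y) \<longlonglongrightarrow> U *v y" for y
      by (simp add: LIM_zero_iff)
    have "(\<lambda>k. q k - p) \<longlonglongrightarrow> 0"
    proof (rule Lim_null_comparison)
      show "\<forall>\<^sub>F k in sequentially. norm (q k - p) \<le> C * (1 / 2) ^ k"
        using q_p by simp
      show "(\<lambda>k. C * (1 / 2) ^ k) \<longlonglongrightarrow> 0"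
        by (intro tendsto_mult_right_zero LIMSEQ_realpow_zero) auto
    qed
    then have "q \<longlonglongrightarrow> p"
      by (simp add: LIM_zero_iff)
    then show "(\<lambda>k. sim c 1 (W k) (q k) x) \<longlonglongrightarrow> sim c 1 U p x"
      using x unfolding sim_def by (auto intro!: tendsto_intros Wl)
  qed
  then obtain k where "sim c 1 (W k) (q k) = sim c 1 U p"
    unfolding eventually_sequentially by blast
  then have k: "W k *v a \<in> span {a} \<and> q k \<in> span {a}"
    using sim_1_eqD[of c "W k" "q k" U p] u(3,6) by (simp add: span_base)
  have "W k *v a \<in> span {a} \<and> q k \<in> span {a} \<Longrightarrow> W 0 *v a \<in> span {a} \<and> q 0 \<in> span {a}" for k
  proof (induction k)
    case (Suc k)
    then have "W (Suc k) *v a \<in> span {a}" "q k + W k *v p - W (Suc k) *v q k \<in> span {a}"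
      by (simp_all add: qS)
    then have "W k *v a \<in> span {a}" "q k \<in> span {a}"
      unfolding WS using preserves_axis_if_conjugate_preserves_axis[OF u(2-5) W u(6)] by blast+
    then show ?case
      using Suc.IH by blast
  qed
  then show ?thesis
    using k W0 q0 by metis
qed

text \<open>All elements preserve the axis \<open>c + \<real> a\<close>, so \<open>B a = \<plusminus> a\<close>. If the sign were negative, the
  element would reverse the axis and fix a point of it, the midpoint between \<open>c\<close> and its
  image, against freeness.\<close>

lemma translation_along_axis:
  assumes g: "sim c 1 A a \<in> G" "orthogonal_matrix A" "A *v a = a" "a \<noteq> 0" "infinite_order A"
    and f: "f \<in> G"
  obtains B k where "orthogonal_matrix B" "B *v a = a" "f = sim c 1 B (k *\<^sub>R a)"
proof -
  have "sim c 1 A a \<noteq> (\<lambda>p\<in>H4. p)"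
  proof
    assume "sim c 1 A a = (\<lambda>p\<in>H4. p)"
    from fun_cong[OF this, of "(c, 1)"] show False
      using g(4) by (simp add: sim_def H4_def)
  qed
  then obtain B b where B: "orthogonal_matrix B" "f = sim c 1 B b"
    using isometries_if_isometry[OF g(1) _ f] by metis
  obtain n where n: "n > 0" "\<And>x. norm (matpow A n *v x - x) \<le> 1 / 10 * norm x"
    using matpow_near_identity[OF g(2), of "1 / 10"] by auto
  have power: "sim c 1 (matpow A (Suc m)) (Suc m *\<^sub>R a) \<in> G" for m
  proof (induction m)
    case (Suc m)
    have "compose H4 (sim c 1 A a) (sim c 1 (matpow A (Suc m)) (Suc m *\<^sub>R a)) \<in> G"
      by (intro comp g Suc)
    moreover have "a + 1 *\<^sub>R (A *v (Suc m *\<^sub>R a)) = Suc (Suc m) *\<^sub>R a"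
      unfolding of_nat_Suc[of "Suc m"]
      by (simp only: matrix_vector_mult_scaleR g(3) scaleR_left_distrib scaleR_one)
    ultimately show ?case
      by (simp only: sim_comp zero_less_one mult_1 funpow.simps o_apply)
  qed (use g in simp)
  have "matpow A n ** matpow A n \<noteq> mat 1"
    using g(5) n(1) by (simp add: infinite_order_def flip: matpow_add)
  moreover have "sim c 1 (matpow A n) (n *\<^sub>R a) \<in> G"
    using power[of "n - 1"] n(1) by simp
  ultimately have "B *v a \<in> span {a} \<and> b \<in> span {a}"
    using f B g(4) by (intro preserves_axis_of_screw[OF _ orthogonal_matpow[OF g(2)] matpow_fixes[OF g(3)] _ _ _ n(2)])
      (auto intro: span_mul span_base)
  then obtain s k where k: "B *v a = s *\<^sub>R a" "b = k *\<^sub>R a"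
    by (auto simp: span_singleton)
  have "\<bar>s\<bar> * norm a = norm a"
    using arg_cong[OF k(1), of norm] B(1) by simp
  then have "s = 1 \<or> s = -1"
    using g(4) by auto
  moreover have "s \<noteq> -1"
  proof
    assume s: "s = -1"
    define m where "m = (k / 2) *\<^sub>R a"
    have "B *v m = - m"
      by (simp add: m_def matrix_vector_mult_scaleR k s)
    moreover have "k *\<^sub>R a = m + m"
      unfolding m_def by (metis scaleR_left_distrib field_sum_of_halves)
    ultimately have "f (c + m, 1) = (c + (- m + (m + m)), 1)"
      by (simp add: B(2) k(2) sim_def H4_def)
    then have "f (c + m, 1) = (c + m, 1)"
      by (simp only: minus_add_cancel)
    then have "f = sim c 1 (mat 1) 0"
      unfolding sim_id by (rule free[OF f, rotated]) (simp add: H4_def)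
    then have "B = mat 1"
      using B(2) sim_1_eqD(1) by metis
    then show False
      using k(1) s g(4) scaleR_cancel_right[of 1 a "-1"] by simp
  qed
  ultimately show thesis
    using that B k by simp
qed

end

section \<open>The stabilizer of infinity\<close>

text \<open>All the maps agree outside \<open>H4\<close>, so pointwise convergence on \<open>H4\<close> is convergence in the
  product topology.\<close>

lemma isolated_pointwise:
  assumes "discrete \<Gamma>" "g \<in> \<Gamma>" "\<Gamma> \<subseteq> extensional H4" "\<And>n :: nat. F n \<in> \<Gamma>"
    and lim: "\<And>p. p \<in> H4 \<Longrightarrow> (\<lambda>n. F n p) \<longlonglongrightarrow> g p"
  shows "\<forall>\<^sub>F n in sequentially. F n = g"
proof -
  have "(\<lambda>n. F n p) \<longlonglongrightarrow> g p" for p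
  proof (cases "p \<in> H4")
    case False
    then have "F n p = g p" for n
      using assms(2-4) by (metis extensional_arb subsetD)
    then show ?thesis by simp
  qed (rule lim)
  then have "limitin (product_topology (\<lambda>_. euclidean) UNIV) F g sequentially"
    by (simp add: limitin_componentwise)
  then have "F \<longlonglongrightarrow> g"
    by (simp add: euclidean_product_topology)
  moreover obtain T where T: "open T" "T \<inter> \<Gamma> = {g}"
    using assms(1,2) by (metis discreteD isolated_inE)
  ultimately have "\<forall>\<^sub>F n in sequentially. F n \<in> T"
    by (metis IntD1 insertI1 topological_tendstoD)
  then show ?thesis
    by eventually_elim (use T assms(4) in blast)
qed

lemma inv_sim:
  assumes f: "sim c l B b \<in> carrier Isom_plus" and B: "l > 0" "orthogonal_matrix B"
  shows "inv\<^bsub>Isom_plus\<^esub> (sim c l B b) = sim c (1 / l) (transpose B) (- (1 / l) *\<^sub>R (transpose B *v b))"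
    (is "inv\<^bsub>Isom_plus\<^esub> ?f = ?g")
proof (rule extensionalityI)
  have "inv\<^bsub>Isom_plus\<^esub> ?f \<in> carrier Isom_plus"
    using group.inv_closed[OF group_Isom_plus f] .
  then show "inv\<^bsub>Isom_plus\<^esub> ?f \<in> extensional H4"
    using hyp_isometryD(1) Bij_imp_extensional by auto
  show "?g \<in> extensional H4"
    by (simp add: sim_def)
  fix p assume p: "p \<in> H4"
  then have "?g p \<in> H4"
    using B by (simp add: sim_in_H4)
  moreover have "?f (?g p) = p"
    using fun_cong[OF sim_comp_inverse(1)[OF B, of c b], of p] p by (simp add: compose_eq)
  ultimately show "(inv\<^bsub>Isom_plus\<^esub> ?f) p = ?g p"
    using Isom_plus_inv_apply(1)[OF f] by metis
qed

lemma stabilizer_similarity: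
  assumes "\<Gamma> \<subseteq> carrier Isom_plus" "f \<in> boundary_stabilizer \<Gamma> Infinity_Pt"
  obtains l B b where "l > 0" "orthogonal_matrix B" "f = sim c l B b"
proof -
  have "hyp_isometry f" "boundary_maps_to f Infinity_Pt Infinity_Pt"
    using assms by (auto simp: boundary_stabilizer_def)
  then show thesis
    using fixes_infinity_sim that by metis
qed

lemma stabilizer_subgroup:
  assumes "subgroup \<Gamma> Isom_plus"
  shows "subgroup (boundary_stabilizer \<Gamma> Infinity_Pt) Isom_plus"
proof (rule group.subgroupI[OF group_Isom_plus])
  let ?S = "boundary_stabilizer \<Gamma> Infinity_Pt"
  have \<Gamma>: "\<Gamma> \<subseteq> carrier Isom_plus"
    using assms by (rule subgroup.subset)
  show S: "?S \<subseteq> carrier Isom_plus"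
    using \<Gamma> by (auto simp: boundary_stabilizer_def)
  have "\<one>\<^bsub>Isom_plus\<^esub> \<in> ?S"
    using subgroup.one_closed[OF assms] sim_fixes_infinity[of 1 "mat 1" 0 0]
    by (simp add: boundary_stabilizer_def sim_id orthogonal_matrix_id)
  then show "?S \<noteq> {}" by blast
  fix f assume f: "f \<in> ?S"
  then obtain l B b where B: "l > 0" "orthogonal_matrix B" "f = sim 0 l B b"
    using stabilizer_similarity[OF \<Gamma>] by metis
  have "inv\<^bsub>Isom_plus\<^esub> f \<in> \<Gamma>"
    using f subgroup.m_inv_closed[OF assms] by (simp add: boundary_stabilizer_def)
  moreover have "f \<in> carrier Isom_plus"
    using f S by blast
  ultimately show "inv\<^bsub>Isom_plus\<^esub> f \<in> ?S"
    using B inv_sim[of 0 l B b] sim_fixes_infinity[of "1 / l" "transpose B"]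
    by (simp add: boundary_stabilizer_def)
  fix g assume g: "g \<in> ?S"
  then obtain l' B' b' where B': "l' > 0" "orthogonal_matrix B'" "g = sim 0 l' B' b'"
    using stabilizer_similarity[OF \<Gamma>] by metis
  have "f \<otimes>\<^bsub>Isom_plus\<^esub> g \<in> \<Gamma>"
    using f g subgroup.m_closed[OF assms] by (simp add: boundary_stabilizer_def)
  moreover have "f \<otimes>\<^bsub>Isom_plus\<^esub> g = compose H4 f g"
    using f g S by (intro Isom_plus_mult_apply) auto
  moreover have "compose H4 f g = sim 0 (l * l') (B ** B') (b + l *\<^sub>R (B *v b'))"
    unfolding B(3) B'(3) by (rule sim_comp[OF B'(1)])
  ultimately show "f \<otimes>\<^bsub>Isom_plus\<^esub> g \<in> ?S"
    using sim_fixes_infinity[of "l * l'" "B ** B'" 0] B B'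
    by (simp add: boundary_stabilizer_def orthogonal_matrix_mul)
qed

lemma discrete_similarity_group_stabilizer:
  assumes "discrete_subgroup \<Gamma>" "acts_freely \<Gamma>"
  shows "discrete_similarity_group (boundary_stabilizer \<Gamma> Infinity_Pt)" (is "discrete_similarity_group ?S")
proof
  have sub: "subgroup \<Gamma> Isom_plus" and disc: "discrete \<Gamma>"
    using assms(1) by (auto simp: discrete_subgroup_def)
  have subS: "subgroup ?S Isom_plus"
    by (rule stabilizer_subgroup[OF sub])
  have S: "?S \<subseteq> carrier Isom_plus"
    by (rule subgroup.subset[OF subS])
  have S\<Gamma>: "?S \<subseteq> \<Gamma>"
    by (auto simp: boundary_stabilizer_def)
  show "\<exists>l B b. l > 0 \<and> orthogonal_matrix B \<and> f = sim c l B b" if "f \<in> ?S" for f c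
    using stabilizer_similarity[OF subgroup.subset[OF sub] that, of c] by metis
  show "compose H4 f g \<in> ?S" if fg: "f \<in> ?S" "g \<in> ?S" for f g
    using subgroup.m_closed[OF subS fg]
    by (simp only: Isom_plus_mult_apply[OF subsetD[OF S fg(1)] subsetD[OF S fg(2)]])
  show "sim c (1 / l) (transpose B) (- (1 / l) *\<^sub>R (transpose B *v b)) \<in> ?S"
    if f: "sim c l B b \<in> ?S" "l > 0" "orthogonal_matrix B" for c l B b
    using subgroup.m_inv_closed[OF subS f(1)]
    by (simp only: inv_sim[OF subsetD[OF S f(1)] f(2,3)])
  show "f = (\<lambda>p\<in>H4. p)" if "f \<in> ?S" "p \<in> H4" "f p = p" for f p
    using assms(2) that S\<Gamma> by (auto simp: acts_freely_def)
  show "\<forall>\<^sub>F n in sequentially. F n = g"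
    if "\<And>n. F n \<in> ?S" "g \<in> ?S" "\<And>p. p \<in> H4 \<Longrightarrow> (\<lambda>n. F n p) \<longlonglongrightarrow> g p" for F :: "nat \<Rightarrow> hpoint \<Rightarrow> hpoint" and g
  proof (rule isolated_pointwise[OF disc])
    have "\<Gamma> \<subseteq> carrier Isom_plus"
      by (rule subgroup.subset[OF sub])
    then show "\<Gamma> \<subseteq> extensional H4"
      using hyp_isometryD(1) Bij_imp_extensional by auto
  qed (use that S\<Gamma> in blast)+
qed

text \<open>The definition conjugates \<open>\<gamma>\<close> to a screw motion by an arbitrary isometry \<open>h\<close>, and the point is that
  \<open>h\<close> fixes \<open>\<infinity>\<close>. First, the displacement of a screw motion at height \<open>T\<close> above the axis
  tends to \<open>0\<close> as \<open>T\<close> grows, whereas the displacement of a similarity with ratio \<open>l \<noteq> 1\<close> is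
  bounded away from \<open>0\<close>; so \<open>\<gamma>\<close> has ratio \<open>1\<close>. Therefore the orbit \<open>\<gamma>\<^sup>k P\<close> stays at one height and,
  as its hyperbolic distance from \<open>P\<close> is unbounded, tends to \<open>\<infinity>\<close>; so does its image under \<open>h\<close>, which
  is an orbit of the screw motion. Hence \<open>h\<close> is a similarity, and conjugating back by it gives the
  claim, with the centre \<open>c = h\<^sup>-\<^sup>1(0)\<close>.\<close>

lemma screw_normal_form_at_infinity:
  assumes \<gamma>: "\<gamma> \<in> carrier Isom_plus" "boundary_maps_to \<gamma> Infinity_Pt Infinity_Pt"
    and "irrational_screw_translation \<gamma>"
  obtains c A a where "orthogonal_matrix A" "A *v a = a" "a \<noteq> 0" "infinite_order A" "\<gamma> = sim c 1 A a"
proof -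
  obtain A a h where A: "orthogonal_matrix A" "infinite_order A" "a \<noteq> 0" "A *v a = a"
    and h: "h \<in> carrier Isom_plus"
    and conj: "h \<otimes>\<^bsub>Isom_plus\<^esub> \<gamma> \<otimes>\<^bsub>Isom_plus\<^esub> inv\<^bsub>Isom_plus\<^esub> h = parabolic_normal_form A a"
    using assms(3) by (auto simp: irrational_screw_translation_def rotational_part_def rotation_matrix_def)
  interpret group Isom_plus by (rule group_Isom_plus)
  have h_iso: "hyp_isometry h" and \<gamma>_iso: "hyp_isometry \<gamma>"
    using h \<gamma> by auto
  have h_inv: "(inv\<^bsub>Isom_plus\<^esub> h) p \<in> H4" "h ((inv\<^bsub>Isom_plus\<^esub> h) p) = p" if "p \<in> H4" for p
    using Isom_plus_inv_apply[OF h that] by auto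
  have h\<gamma>: "h (\<gamma> p) = (A *v fst (h p) + a, snd (h p))" if p: "p \<in> H4" for p
  proof -
    have hp: "h p \<in> H4"
      using hyp_isometryD(2)[OF h_iso p] .
    have "h \<otimes>\<^bsub>Isom_plus\<^esub> \<gamma> \<otimes>\<^bsub>Isom_plus\<^esub> inv\<^bsub>Isom_plus\<^esub> h = compose H4 (compose H4 h \<gamma>) (inv\<^bsub>Isom_plus\<^esub> h)"
      using h \<gamma>(1) m_closed[OF h \<gamma>(1)] by (simp only: Isom_plus_mult_apply inv_closed)
    then have "compose H4 (compose H4 h \<gamma>) (inv\<^bsub>Isom_plus\<^esub> h) (h p) = parabolic_normal_form A a (h p)"
      using conj by metis
    then show ?thesis
      using hp p Isom_plus_inv_apply(1)[OF h p] by (simp add: compose_eq parabolic_normal_form_def)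
  qed
  obtain l B b where B: "l > 0" "orthogonal_matrix B" "\<gamma> = sim 0 l B b"
    using fixes_infinity_sim[OF \<gamma>_iso \<gamma>(2)] by metis
  have snd_\<gamma>: "snd (\<gamma> p) = l * snd p" if "p \<in> H4" for p
    using that by (simp add: B(3) sim_def)
  have "l = 1"
  proof (rule ccontr)
    assume "l \<noteq> 1"
    \<comment> \<open>A lower bound for the displacement quotient of \<open>\<gamma>\<close>, from the change of height alone.\<close>
    define \<delta> where "\<delta> = (1 - l)\<^sup>2 / l"
    have \<delta>: "\<delta> > 0"
      using B(1) \<open>l \<noteq> 1\<close> by (simp add: \<delta>_def)
    \<comment> \<open>High enough that the screw motion has displacement quotient \<open>norm a\<^sup>2 / T\<^sup>2\<close> below \<open>\<delta>\<close>.\<close>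
    define T where "T = (norm a + 1) / sqrt \<delta>"
    have T: "T > 0"
      using \<delta> by (simp add: T_def add_nonneg_pos)
    define p where "p = (inv\<^bsub>Isom_plus\<^esub> h) (0, T)"
    have "(0, T) \<in> H4"
      using T by (simp add: H4_def)
    then have p: "p \<in> H4" "h p = (0, T)"
      using h_inv by (simp_all add: p_def)
    then have t: "snd p > 0"
      by (auto simp: H4_def)
    have "(dist (h p) (h (\<gamma> p)))\<^sup>2 / (snd (h p) * snd (h (\<gamma> p))) = (dist p (\<gamma> p))\<^sup>2 / (snd p * snd (\<gamma> p))"
      using hyp_isometry_dist[OF h_iso p(1) hyp_isometryD(2)[OF \<gamma>_iso p(1)]] .
    moreover have "dist (h p) (h (\<gamma> p)) = norm a"
      by (simp add: h\<gamma>[OF p(1)] p(2) dist_Pair_Pair)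
    ultimately have eq: "(norm a)\<^sup>2 / (T * T) = (dist p (\<gamma> p))\<^sup>2 / (snd p * (l * snd p))"
      by (simp add: h\<gamma>[OF p(1)] p(2) snd_\<gamma>[OF p(1)])
    have "\<bar>(1 - l) * snd p\<bar> \<le> dist p (\<gamma> p)"
      using dist_snd_le[of p "\<gamma> p"] by (simp add: snd_\<gamma>[OF p(1)] dist_real_def algebra_simps)
    then have "((1 - l) * snd p)\<^sup>2 \<le> (dist p (\<gamma> p))\<^sup>2"
      by (metis abs_ge_zero power2_abs power_mono)
    then have "((1 - l) * snd p)\<^sup>2 / (snd p * (l * snd p)) \<le> (norm a)\<^sup>2 / (T * T)"
      unfolding eq using t B(1) by (intro divide_right_mono) auto
    moreover have "((1 - l) * snd p)\<^sup>2 / (snd p * (l * snd p)) = \<delta>"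
      using t B(1) by (simp add: \<delta>_def power2_eq_square field_simps)
    moreover have "(norm a)\<^sup>2 / (T * T) = \<delta> * ((norm a)\<^sup>2 / (norm a + 1)\<^sup>2)"
      using \<delta> by (simp add: T_def power2_eq_square field_simps)
    moreover have "(norm a)\<^sup>2 / (norm a + 1)\<^sup>2 < 1"
      by (simp add: power_strict_mono divide_less_eq_1 add_nonneg_pos)
    ultimately show False
      using \<delta> by (metis mult.right_neutral mult_less_cancel_left_pos not_le)
  qed
  define P where "P = (inv\<^bsub>Isom_plus\<^esub> h) (0, 1)"
  have P: "P \<in> H4" "h P = (0, 1)"
    using h_inv[of "(0, 1)"] by (simp_all add: P_def H4_def)
  define q where "q k = (\<gamma> ^^ k) P" for k
  have q: "q k \<in> H4 \<and> snd (q k) = snd P \<and> h (q k) = (real k *\<^sub>R a, 1)" for k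
  proof (induction k)
    case (Suc k)
    then have "q (Suc k) = \<gamma> (q k)"
      by (simp add: q_def)
    then show ?case
      using Suc hyp_isometryD(2)[OF \<gamma>_iso, of "q k"] snd_\<gamma>[of "q k"] h\<gamma>[of "q k"] \<open>l = 1\<close>
      by (simp add: matrix_vector_mult_scaleR A(4) algebra_simps)
  qed (simp add: q_def P)
  have t: "snd P > 0"
    using P(1) by (auto simp: H4_def)
  have dist_q: "dist P (q k) = k * (norm a * snd P)" for k
  proof -
    have "(dist (h P) (h (q k)))\<^sup>2 = (k * norm a)\<^sup>2"
      using q[of k] by (simp add: P(2) dist_Pair_Pair)
    then have "(k * norm a)\<^sup>2 = (dist P (q k))\<^sup>2 / (snd P * snd P)"
      using hyp_isometry_dist[OF h_iso P(1), of "q k"] q[of k] by (simp add: P(2))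
    then have "(dist P (q k))\<^sup>2 = (k * (norm a * snd P))\<^sup>2"
      using t by (simp add: power2_eq_square field_simps)
    then show ?thesis
      using t by (simp add: power2_eq_iff_nonneg)
  qed
  have lin_top: "filterlim (\<lambda>k. real k * x) at_top sequentially" if "x > 0" for x
    using that by (intro filterlim_at_top_mult_tendsto_pos[OF tendsto_const _ filterlim_real_sequentially])
  have "filterlim (\<lambda>k. norm (q k)) at_top sequentially"
  proof (rule filterlim_at_top_mono)
    show "filterlim (\<lambda>k. - norm P + k * (norm a * snd P)) at_top sequentially"
      using A(3) t by (intro filterlim_tendsto_add_at_top[OF tendsto_const] lin_top) simp
    have "- norm P + k * (norm a * snd P) \<le> norm (q k)" for k
      using norm_triangle_ineq4[of P "q k"] by (simp add: dist_norm flip: dist_q)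
    then show "\<forall>\<^sub>F k in sequentially. - norm P + k * (norm a * snd P) \<le> norm (q k)"
      by simp
  qed
  then have q_lim: "filterlim q at_infinity sequentially"
    by (rule filterlim_norm_at_top_imp_at_infinity)
  have "filterlim (\<lambda>k. norm (h (q k))) at_top sequentially"
  proof (rule filterlim_at_top_mono)
    show "filterlim (\<lambda>k. real k * norm a) at_top sequentially"
      using A(3) by (intro lin_top) simp
    have "real k * norm a \<le> norm (h (q k))" for k
      using norm_fst_le[of "real k *\<^sub>R a" "1 :: real"] q[of k] by simp
    then show "\<forall>\<^sub>F k in sequentially. real k * norm a \<le> norm (h (q k))"
      by simp
  qed
  then have hq_lim: "filterlim (\<lambda>k. h (q k)) at_infinity sequentially"
    by (rule filterlim_norm_at_top_imp_at_infinity)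
  obtain \<mu> C d where C: "\<mu> > 0" "orthogonal_matrix C" "h = sim 0 \<mu> C d"
    using hyp_isometry_eq_sim[OF h_iso _ q_lim hq_lim] q by metis
  note cancel = orthogonal_mult_cancel[OF C(2)]
  define c where "c = - (1 / \<mu>) *\<^sub>R (transpose C *v d)"
  define A' where "A' = transpose C ** A ** C"
  define a' where "a' = (1 / \<mu>) *\<^sub>R (transpose C *v a)"
  have Cc: "\<mu> *\<^sub>R (C *v c) = - d"
    unfolding c_def matrix_vector_mult_scaleR cancel using C(1) by simp
  have Ca': "\<mu> *\<^sub>R (C *v a') = a"
    unfolding a'_def matrix_vector_mult_scaleR cancel using C(1) by simp
  have CA': "C *v (A' *v x) = A *v (C *v x)" for x
    unfolding A'_def matrix_vector_mul_assoc[symmetric] cancel ..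
  show thesis
  proof
    show "orthogonal_matrix A'"
      using C(2) A(1) by (simp add: A'_def orthogonal_matrix_mul)
    show "infinite_order A'"
      unfolding A'_def using C(2) A(2) by (rule infinite_order_conj)
    show "a' \<noteq> 0"
      using Ca' A(3) by auto
    show "A' *v a' = a'"
      unfolding A'_def a'_def matrix_vector_mult_scaleR matrix_vector_mul_assoc[symmetric] cancel A(4) ..
    show "\<gamma> = sim c 1 A' a'"
    proof (rule extensionalityI)
      show "\<gamma> \<in> extensional H4" "sim c 1 A' a' \<in> extensional H4"
        by (simp_all add: B(3) sim_def)
      fix p assume p: "p \<in> H4"
      have \<gamma>p: "\<gamma> p \<in> H4" and sp: "sim c 1 A' a' p \<in> H4"
        using hyp_isometryD(2)[OF \<gamma>_iso p] sim_in_H4[of 1 p] p by auto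
      have "fst (h (sim c 1 A' a' p)) = \<mu> *\<^sub>R (C *v c) + \<mu> *\<^sub>R (A *v (C *v (fst p - c))) + \<mu> *\<^sub>R (C *v a') + d"
        using p sp by (simp add: C(3) sim_def H4_def matrix_vector_right_distrib CA' scaleR_right_distrib)
      also have "\<dots> = \<mu> *\<^sub>R (A *v (C *v (fst p - c))) + a"
        by (simp add: Ca' Cc)
      also have "\<dots> = A *v (\<mu> *\<^sub>R (C *v fst p) - \<mu> *\<^sub>R (C *v c)) + a"
        by (simp add: matrix_vector_mult_diff_distrib matrix_vector_mult_scaleR scaleR_right_diff_distrib)
      also have "\<dots> = fst (h (\<gamma> p))"
        using p by (simp add: h\<gamma> Cc) (simp add: C(3) sim_def)
      finally have "fst (h (sim c 1 A' a' p)) = fst (h (\<gamma> p))" .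
      moreover have "snd (h (sim c 1 A' a' p)) = snd (h (\<gamma> p))"
        using p \<gamma>p sp snd_\<gamma>[OF p] \<open>l = 1\<close> by (simp add: C(3) sim_def)
      ultimately have "h (sim c 1 A' a' p) = h (\<gamma> p)"
        by (simp add: prod_eq_iff)
      then show "\<gamma> p = sim c 1 A' a' p"
        using hyp_isometryD(4)[OF h_iso \<gamma>p sp] by simp
    qed
  qed
qed

theorem theorem2p5:
  fixes \<Gamma> :: "(hpoint \<Rightarrow> hpoint) set"
  assumes "discrete_subgroup \<Gamma>"
    and "acts_freely \<Gamma>"
    and "parabolic_fixed_point \<Gamma> Infinity_Pt"
    and "\<exists>\<gamma>\<in>boundary_stabilizer \<Gamma> Infinity_Pt. irrational_screw_translation \<gamma>"
  shows "cyclic_group (Isom_plus\<lparr>carrier := boundary_stabilizer \<Gamma> Infinity_Pt\<rparr>)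
    \<and> infinite (boundary_stabilizer \<Gamma> Infinity_Pt)"
proof -
  let ?S = "boundary_stabilizer \<Gamma> Infinity_Pt"
  let ?G = "Isom_plus\<lparr>carrier := ?S\<rparr>"
  interpret discrete_similarity_group ?S
    using assms(1,2) by (rule discrete_similarity_group_stabilizer)
  have sub: "subgroup ?S Isom_plus"
    using assms(1) by (simp add: stabilizer_subgroup discrete_subgroup_def)
  have S: "?S \<subseteq> carrier Isom_plus"
    by (rule subgroup.subset[OF sub])
  obtain \<gamma> where \<gamma>: "\<gamma> \<in> ?S" "irrational_screw_translation \<gamma>"
    using assms(4) by blast
  have "\<gamma> \<in> carrier Isom_plus" "boundary_maps_to \<gamma> Infinity_Pt Infinity_Pt"
    using \<gamma>(1) S by (auto simp: boundary_stabilizer_def)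
  then obtain c A a where A: "orthogonal_matrix A" "A *v a = a" "a \<noteq> 0" "infinite_order A" "\<gamma> = sim c 1 A a"
    using screw_normal_form_at_infinity[OF _ _ \<gamma>(2)] by metis
  have screw: "sim c 1 A a \<in> ?S"
    using \<gamma>(1) A(5) by simp
  \<comment> \<open>The \<open>k\<close> for which \<open>f\<close> moves \<open>c\<close> by \<open>k a\<close>.\<close>
  define \<phi> where "\<phi> f = ((fst (f (c, 1)) - c) \<bullet> a) / (a \<bullet> a)" for f :: "hpoint \<Rightarrow> hpoint"
  have \<phi>_sim: "\<phi> (sim c 1 B (k *\<^sub>R a)) = k" for B k
    using A(3) by (simp add: \<phi>_def sim_def H4_def)
  have rep: "\<exists>B. orthogonal_matrix B \<and> B *v a = a \<and> f = sim c 1 B (\<phi> f *\<^sub>R a)" if f: "f \<in> ?S" for f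
  proof -
    obtain B k where "orthogonal_matrix B" "B *v a = a" "f = sim c 1 B (k *\<^sub>R a)"
      using translation_along_axis[OF screw A(1-4) f] .
    then show ?thesis
      using \<phi>_sim by metis
  qed
  have "cyclic_group ?G \<and> infinite (carrier ?G)"
  proof (rule cyclic_group_if_locally_finite_real_hom)
    show "group ?G"
      using sub group_Isom_plus by (rule subgroup.subgroup_is_group)
    show "\<phi> (f \<otimes>\<^bsub>?G\<^esub> g) = \<phi> f + \<phi> g" if fg: "f \<in> carrier ?G" "g \<in> carrier ?G" for f g
    proof -
      obtain B r where B: "B *v a = a" and f: "f = sim c 1 B (r *\<^sub>R a)"
        using rep[of f] fg(1) by auto
      obtain C s where g: "g = sim c 1 C (s *\<^sub>R a)"
        using rep[of g] fg(2) by auto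
      have "f \<otimes>\<^bsub>?G\<^esub> g = compose H4 f g"
        using fg S Isom_plus_mult_apply[of f g] by auto
      also have "\<dots> = sim c 1 (B ** C) ((r + s) *\<^sub>R a)"
        by (simp add: f g sim_comp matrix_vector_mult_scaleR B scaleR_left_distrib)
      finally show ?thesis
        by (simp only: f g \<phi>_sim)
    qed
    show "f = \<one>\<^bsub>?G\<^esub>" if f: "f \<in> carrier ?G" "\<phi> f = 0" for f
    proof -
      obtain B where "f = sim c 1 B 0"
        using rep[of f] f by auto
      then have "f (c, 1) = (c, 1)"
        by (simp add: sim_def H4_def)
      then show ?thesis
        using free[of f "(c, 1)"] f(1) by (simp add: H4_def)
    qed
    show "finite {f \<in> carrier ?G. \<bar>\<phi> f\<bar> \<le> R}" for R
    proof (rule finite_subset[OF _ finite_bounded_isometries[of "R * norm a" c]], safe)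
      fix f assume f: "f \<in> carrier ?G" "\<bar>\<phi> f\<bar> \<le> R"
      then have bound: "norm (\<phi> f *\<^sub>R a) \<le> R * norm a"
        by (simp add: mult_right_mono)
      obtain B where "orthogonal_matrix B" "f = sim c 1 B (\<phi> f *\<^sub>R a)"
        using rep[of f] f(1) by auto
      with bound show "\<exists>B b. orthogonal_matrix B \<and> norm b \<le> R * norm a \<and> f = sim c 1 B b"
        by blast
    qed simp
    show "\<gamma> \<in> carrier ?G"
      using \<gamma>(1) by simp
    show "\<phi> \<gamma> \<noteq> 0"
      using \<phi>_sim[of A 1] A(5) by simp
  qed
  then show ?thesis
    by simp
qed

end
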